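(* There exist a constant $\alpha < 2\sqrt{\ln 2}$ and an integer $\Delta_0$ such that for every integer $\Delta \ge \Delta_0$ the following holds: if $G$ is a random $\Delta$-regular graph on $n$ vertices (in the configuration model described in the context), then $$\Pr\left[\, i(G) \ge \left(1-\frac{\alpha}{\sqrt{\Delta}}\right)\frac{\Delta}{2} \,\right] \to 1 \quad \text{as } n\to\infty \ (\text{over } n \text{ with } \Delta n \text{ even}).$$
   Context: Random $\Delta$-regular graph (configuration model): take $\Delta n$ points numbered $0,\dots,\Delta n-1$ ($\Delta n$ even), choose a perfect matching on them uniformly at random, and for each $k\in\{0,\dots,n-1\}$ merge the points $k\Delta, k\Delta+1,\dots,(k+1)\Delta-1$ into one vertex of degree $\Delta$; each matched pair becomes an edge (the result may be a multigraph). For a graph $G=(V,E)$ on $n$ vertices and a nonempty $S\subseteq V$, let $c(S)$ be the number of edges with exactly one endpoint in $S$; the edge expansion of $G$ is $i(G)=\min_{\emptyset\ne S\subseteq V,\ |S|\le n/2} c(S)/|S|$. *)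

theory Defs
  imports
    "HOL-Probability.Probability"
    "HOL-Library.Disjoint_Sets"
    "HOL-Library.Multiset"
begin

text \<open>
  A multigraph is a vertex set together with a multiset of edges. An edge is the two-element
  multiset of its endpoints, so \<open>{#v, v#}\<close> is a loop at \<open>v\<close>.
\<close>
type_synonym 'v multigraph = "'v set \<times> 'v multiset multiset"

definition cut_size :: "'v multigraph \<Rightarrow> 'v set \<Rightarrow> nat" where
  "cut_size G S = size {#e \<in># snd G. size {#v \<in># e. v \<in> S#} = 1#}"

text \<open>
  The minimum is meaningful when the vertex set is finite with at least two elements; otherwise
  the set of admissible \<open>S\<close> is infinite or empty.
\<close>
definition edge_expansion :: "'v multigraph \<Rightarrow> real" where
  "edge_expansion G =
     Min ((\<lambda>S. real (cut_size G S) / real (card S)) `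
          {S. S \<noteq> {} \<and> S \<subseteq> fst G \<and> real (card S) \<le> real (card (fst G)) / 2})"

definition perfect_matchings :: "'a set \<Rightarrow> 'a set set set" where
  "perfect_matchings A = {M. partition_on A M \<and> (\<forall>e\<in>M. card e = 2)}"

text \<open>The points \<open>k * d, \<dots>, (k + 1) * d - 1\<close> are exactly those \<open>p\<close> with \<open>p div d = k\<close>.\<close>
definition merge_points :: "nat \<Rightarrow> nat \<Rightarrow> nat set set \<Rightarrow> nat multigraph" where
  "merge_points d n M = ({..<n}, {#{#p div d. p \<in># mset_set e#}. e \<in># mset_set M#})"

definition random_regular_graph :: "nat \<Rightarrow> nat \<Rightarrow> nat multigraph pmf" where
  "random_regular_graph d n =
     map_pmf (merge_points d n) (pmf_of_set (perfect_matchings {..<d * n}))"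

lemma finite_perfect_matchings: "finite A \<Longrightarrow> finite (perfect_matchings A)"
  by (rule finite_subset[of _ "Pow (Pow A)"]) (auto simp: perfect_matchings_def partition_on_def)

text \<open>Hence \<open>pmf_of_set\<close> above is the uniform distribution whenever \<open>d * n\<close> is even.\<close>
lemma perfect_matchings_nonempty:
  assumes "even N"
  shows "perfect_matchings {..<N :: nat} \<noteq> {}"
proof -
  let ?M = "(\<lambda>i. {2 * i, 2 * i + 1}) ` {..<N div 2}"
  have "partition_on {..<N} ?M"
  proof (rule partition_onI)
    show "\<Union>?M = {..<N}"
    proof (intro equalityI subsetI)
      fix p assume "p \<in> {..<N}"
      then have "p div 2 \<in> {..<N div 2}" and "p \<in> {2 * (p div 2), 2 * (p div 2) + 1}"
        using assms by (auto elim!: evenE)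
      then show "p \<in> \<Union>?M" by blast
    qed (use assms in \<open>auto elim!: evenE\<close>)
  qed (auto simp: disjnt_def, presburger+)
  then have "?M \<in> perfect_matchings {..<N}"
    by (auto simp: perfect_matchings_def)
  then show ?thesis by blast
qed

end

theory Submission
  imports Defs "HOL-Real_Asymp.Real_Asymp"
begin

text \<open>
  The plain first moment bound over all vertex sets only gives \<open>\<alpha> > 2 * sqrt (ln 2)\<close>. The gain
  comes from the fact that one sparse cut forces exponentially many almost equally sparse ones:
  flipping each vertex independently with a small probability \<open>\<epsilon>\<close> changes the cut on average by
  \<open>O(\<epsilon>)\<close> per vertex (in the relevant scale), while the entropy of the flips is at least
  \<open>\<epsilon> ln (1 / \<epsilon>)\<close> per vertex. By Jensen's inequality the partition function
  \<open>Z = \<Sum>\<^sub>T exp (- \<theta> H T)\<close> is then large as soon as a single sparse cut exists, and its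
  expectation bounds the probability of that. Here \<open>H\<close> is the cut size plus a multiple of the
  squared imbalance, chosen so that the bound for the expectation of \<open>exp (- \<theta> H T)\<close> does not
  depend on the size of \<open>T\<close>.

  By symmetry, a uniform matching and a fixed set of \<open>a\<close> points may be replaced by a fixed matching
  and a uniform set of \<open>a\<close> points; colouring the points independently instead gives all large
  deviation estimates. Sets with fewer than \<open>\<alpha> n / (2 * sqrt \<Delta>)\<close> vertices are handled by a
  union bound.
\<close>

subsection \<open>Crossing pairs of a uniform matching\<close>

text \<open>Counted on the points before merging, where the matching has its full symmetry. For the
  points of a vertex set \<open>S\<close> this is the cut of \<open>S\<close>, see
  \<open>cut_size_merge_points\<close>.\<close>

definition crossing :: "'a set set \<Rightarrow> 'a set \<Rightarrow> nat" where
  "crossing M A = card {e \<in> M. card (e \<inter> A) = 1}"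

lemma perfect_matchingsD:
  assumes "M \<in> perfect_matchings V" "finite V"
  shows "finite M" "\<Union>M = V" "disjoint M" "\<And>e. e \<in> M \<Longrightarrow> card e = 2 \<and> finite e \<and> e \<subseteq> V"
    "2 * card M = card V"
proof -
  have part: "partition_on V M" and two: "\<And>e. e \<in> M \<Longrightarrow> card e = 2"
    using assms(1) by (auto simp: perfect_matchings_def)
  show un: "\<Union>M = V" and "disjoint M"
    using part by (auto simp: partition_on_def)
  show fin: "finite M"
    using finite_elements[OF assms(2) part] .
  show sub: "\<And>e. e \<in> M \<Longrightarrow> card e = 2 \<and> finite e \<and> e \<subseteq> V"
    using two un assms(2) by (auto intro: finite_subset)
  have "card V = (\<Sum>e\<in>M. card e)"
    unfolding un[symmetric] using \<open>disjoint M\<close> sub by (intro card_Union_disjoint) auto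
  then show "2 * card M = card V"
    using two by simp
qed

lemma image_mem_perfect_matchings:
  assumes "bij_betw \<pi> V V" "M \<in> perfect_matchings V"
  shows "(`) \<pi> ` M \<in> perfect_matchings V"
proof -
  have part: "partition_on V M" and two: "\<And>e. e \<in> M \<Longrightarrow> card e = 2"
    using assms(2) by (auto simp: perfect_matchings_def)
  have inj: "inj_on \<pi> V" and im: "\<pi> ` V = V"
    using assms(1) by (auto simp: bij_betw_def)
  have sub: "\<And>e. e \<in> M \<Longrightarrow> e \<subseteq> V"
    using part by (auto simp: partition_on_def)
  have "partition_on V ((`) \<pi> ` M)"
  proof (rule partition_onI)
    show "\<Union>((`) \<pi> ` M) = V"
      using part im by (metis image_Union partition_on_def)
    fix a b assume "a \<in> (`) \<pi> ` M" "b \<in> (`) \<pi> ` M" "a \<noteq> b"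
    then obtain e f where ef: "e \<in> M" "f \<in> M" "a = \<pi> ` e" "b = \<pi> ` f" "e \<noteq> f" by auto
    then have "e \<inter> f = {}"
      using part by (auto simp: partition_on_def disjoint_def)
    then show "disjnt a b"
      using inj_on_image_Int[OF inj sub[OF ef(1)] sub[OF ef(2)]] ef by (simp add: disjnt_def)
  qed (use two in force)
  moreover have "card (\<pi> ` e) = 2" if "e \<in> M" for e
    using two[OF that] card_image[OF inj_on_subset[OF inj sub[OF that]]] by simp
  ultimately show ?thesis
    using im by (auto simp: perfect_matchings_def)
qed

lemma crossing_image:
  assumes "inj_on \<pi> V" "A \<subseteq> V" "\<And>e. e \<in> M \<Longrightarrow> e \<subseteq> V"
  shows "crossing ((`) \<pi> ` M) (\<pi> ` A) = crossing M A"
proof -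
  have "card (\<pi> ` e \<inter> \<pi> ` A) = card (e \<inter> A)" if "e \<in> M" for e
    using inj_on_image_Int[OF assms(1) assms(3)[OF that] assms(2)] assms(3)[OF that]
    by (metis card_image inf.coboundedI1 inj_on_subset assms(1))
  then have "{e \<in> (`) \<pi> ` M. card (e \<inter> \<pi> ` A) = 1} = (`) \<pi> ` {e \<in> M. card (e \<inter> A) = 1}"
    by auto
  moreover have "inj_on ((`) \<pi>) {e \<in> M. card (e \<inter> A) = 1}"
    by (rule inj_on_subset[OF inj_on_image_Pow[OF assms(1)]]) (use assms(3) in auto)
  ultimately show ?thesis
    unfolding crossing_def by (simp add: card_image)
qed

text \<open>A permutation of \<open>V\<close> that maps \<open>A\<close> onto \<open>B\<close>
  permutes the perfect matchings and carries crossing pairs to crossing pairs. So a random matching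
  with a fixed set can be traded for a fixed matching with a random set of the same size.\<close>

lemma sum_crossing_card_eq:
  fixes f :: "nat \<Rightarrow> 'b::comm_monoid_add"
  assumes "finite V" "A \<subseteq> V" "B \<subseteq> V" "card A = card B"
  shows "(\<Sum>M\<in>perfect_matchings V. f (crossing M A)) = (\<Sum>M\<in>perfect_matchings V. f (crossing M B))"
proof -
  have fin: "finite A" "finite B"
    using assms by (auto intro: finite_subset)
  obtain g where g: "bij_betw g A B"
    using finite_same_card_bij[OF fin assms(4)] by auto
  have "card (V - A) = card (V - B)"
    using assms fin by (simp add: card_Diff_subset)
  then obtain h where h: "bij_betw h (V - A) (V - B)"
    using finite_same_card_bij assms(1) by (metis finite_Diff)
  define \<pi> where "\<pi> x = (if x \<in> A then g x else h x)" for x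
  have \<pi>A: "bij_betw \<pi> A B"
    using g by (rule bij_betw_cong[THEN iffD1, rotated]) (auto simp: \<pi>_def)
  have "bij_betw \<pi> (V - A) (V - B)"
    using h by (rule bij_betw_cong[THEN iffD1, rotated]) (auto simp: \<pi>_def)
  then have "bij_betw \<pi> (A \<union> (V - A)) (B \<union> (V - B))"
    by (intro bij_betw_combine[OF \<pi>A]) auto
  then have \<pi>: "bij_betw \<pi> V V"
    using assms by (simp add: Un_absorb1)
  have inj: "inj_on \<pi> V"
    using \<pi> by (simp add: bij_betw_def)
  have sub: "e \<subseteq> V" if "M \<in> perfect_matchings V" "e \<in> M" for M e
    using that perfect_matchingsD(4)[OF that(1) assms(1)] by blast
  let ?P = "perfect_matchings V"
  have injP: "inj_on ((`) ((`) \<pi>)) ?P"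
    by (rule inj_on_subset[OF inj_on_image_Pow[OF inj_on_image_Pow[OF inj]]]) (use sub in auto)
  have "(`) ((`) \<pi>) ` ?P \<subseteq> ?P"
    using image_mem_perfect_matchings[OF \<pi>] by auto
  then have "(`) ((`) \<pi>) ` ?P = ?P"
    by (intro endo_inj_surj finite_perfect_matchings assms injP)
  then have bij: "bij_betw ((`) ((`) \<pi>)) ?P ?P"
    using injP by (simp add: bij_betw_def)
  have "(\<Sum>M\<in>?P. f (crossing M B)) = (\<Sum>M\<in>?P. f (crossing ((`) \<pi> ` M) B))"
    using sum.reindex_bij_betw[OF bij, of "\<lambda>M. f (crossing M B)"] by simp
  also have "\<dots> = (\<Sum>M\<in>?P. f (crossing M A))"
  proof (intro sum.cong refl)
    fix M assume "M \<in> ?P"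
    then show "f (crossing ((`) \<pi> ` M) B) = f (crossing M A)"
      using crossing_image[OF inj assms(2), of M] sub \<pi>A by (simp add: bij_betw_def)
  qed
  finally show ?thesis by simp
qed

section \<open>The generating function of the crossing number\<close>

lemma sum_Pow_disjoint_Un:
  assumes "finite A" "finite B" "A \<inter> B = {}"
  shows "(\<Sum>X\<in>Pow (A \<union> B). f X) = (\<Sum>X\<in>Pow A. \<Sum>Y\<in>Pow B. f (X \<union> Y))"
proof -
  have "(\<Sum>X\<in>Pow A. \<Sum>Y\<in>Pow B. f (X \<union> Y)) = (\<Sum>(X, Y)\<in>Pow A \<times> Pow B. f (X \<union> Y))"
    by (rule sum.cartesian_product)
  also have "\<dots> = (\<Sum>X\<in>Pow (A \<union> B). f X)"
    by (rule sum.reindex_bij_witness[of _ "\<lambda>X. (X \<inter> A, X \<inter> B)" "\<lambda>(X, Y). X \<union> Y"])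
       (use assms in auto)
  finally show ?thesis by simp
qed

text \<open>With the matching fixed, the weight factorises over its pairs: a pair contributes
  \<open>p\<^sup>2\<close> if it lies inside \<open>A\<close>, \<open>q\<^sup>2\<close> if it lies
  outside, and \<open>y * p * q\<close> for each of the two ways of being split.\<close>

lemma sum_Pow_pow_crossing:
  fixes p q y :: "'b::comm_semiring_1"
  assumes "finite M" "disjoint M" "\<And>e. e \<in> M \<Longrightarrow> card e = 2"
  shows "(\<Sum>A\<in>Pow (\<Union>M). p ^ card A * q ^ card (\<Union>M - A) * y ^ crossing M A)
    = (p\<^sup>2 + 2 * y * p * q + q\<^sup>2) ^ card M"
  using assms
proof (induction M rule: finite_induct)
  case empty
  then show ?case by (simp add: crossing_def)
next
  case (insert e M)
  have "finite f" if "f \<in> insert e M" for f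
    using insert.prems(2)[OF that] by (simp add: card_ge_0_finite)
  then have fin: "finite e" "finite (\<Union>M)"
    using insert.hyps by auto
  have disj: "e \<inter> \<Union>M = {}"
    using insert by (auto simp: disjoint_def)
  have c: "card (e \<inter> (X \<union> Y)) = card X" "card (X \<union> Y) = card X + card Y"
    "card (e \<union> \<Union>M - (X \<union> Y)) = card (e - X) + card (\<Union>M - Y)"
    "crossing (insert e M) (X \<union> Y) = of_bool (card X = 1) + crossing M Y"
    if "X \<subseteq> e" "Y \<subseteq> \<Union>M" for X Y
  proof -
    have fXY: "finite X" "finite Y"
      using that fin by (auto intro: finite_subset)
    have "e \<inter> (X \<union> Y) = X"
      using that disj by auto
    then show cX: "card (e \<inter> (X \<union> Y)) = card X" by simp
    show "card (X \<union> Y) = card X + card Y"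
      using that disj fXY by (intro card_Un_disjoint) auto
    have "e \<union> \<Union>M - (X \<union> Y) = (e - X) \<union> (\<Union>M - Y)"
      using that disj by auto
    then show "card (e \<union> \<Union>M - (X \<union> Y)) = card (e - X) + card (\<Union>M - Y)"
      using that disj fin by (simp add: card_Un_disjoint disjoint_iff)
    have "e' \<inter> (X \<union> Y) = e' \<inter> Y" if "e' \<in> M" for e'
      using disj \<open>X \<subseteq> e\<close> that by auto
    then have "{e' \<in> insert e M. card (e' \<inter> (X \<union> Y)) = 1}
        = (if card X = 1 then {e} else {}) \<union> {e' \<in> M. card (e' \<inter> Y) = 1}"
      using cX by auto
    moreover have "finite {e' \<in> M. card (e' \<inter> Y) = 1}" "e \<notin> {e' \<in> M. card (e' \<inter> Y) = 1}"
      using insert.hyps by auto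
    ultimately show "crossing (insert e M) (X \<union> Y) = of_bool (card X = 1) + crossing M Y"
      unfolding crossing_def by simp
  qed
  obtain u v where e: "e = {u, v}" "u \<noteq> v"
    using insert.prems(2)[of e] by (auto simp: card_2_iff)
  have "(\<Sum>A\<in>Pow (\<Union>(insert e M)). p ^ card A * q ^ card (\<Union>(insert e M) - A) * y ^ crossing (insert e M) A)
    = (\<Sum>X\<in>Pow e. \<Sum>Y\<in>Pow (\<Union>M). (p ^ card X * q ^ card (e - X) * y ^ of_bool (card X = 1)) *
        (p ^ card Y * q ^ card (\<Union>M - Y) * y ^ crossing M Y))"
    unfolding Union_insert sum_Pow_disjoint_Un[OF fin disj]
    by (intro sum.cong refl) (simp add: c power_add ac_simps)
  also have "\<dots> = (\<Sum>X\<in>Pow e. p ^ card X * q ^ card (e - X) * y ^ of_bool (card X = 1)) *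
      (p\<^sup>2 + 2 * y * p * q + q\<^sup>2) ^ card M"
    using insert by (subst sum_product[symmetric]) (auto simp: disjoint_def)
  also have "(\<Sum>X\<in>Pow e. p ^ card X * q ^ card (e - X) * y ^ of_bool (card X = 1))
      = p\<^sup>2 + 2 * y * p * q + q\<^sup>2"
  proof -
    have "Pow e = {{}, {u}, {v}, {u, v}}"
      unfolding e by auto
    moreover have "{u, v} - {u} = {v}" "{u, v} - {v} = {u}"
      using e by auto
    ultimately show ?thesis
      using e by (simp add: doubleton_eq_iff power2_eq_square algebra_simps flip: mult_2_right)
  qed
  finally show ?case
    using insert by simp
qed

text \<open>By symmetry all sets of size \<open>card A\<close> give the same sum over matchings;
  adding the sets of other sizes only increases the total, and for each matching the sum over all
  sets is the product formula. The weights \<open>p\<close> and \<open>q\<close> stay free because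
  large and small sets call for different choices.\<close>

lemma sum_pow_crossing_le:
  fixes p q y :: real
  assumes "finite V" "A \<subseteq> V" "p \<ge> 0" "q \<ge> 0" "y \<ge> 0"
  shows "real (card V choose card A) * p ^ card A * q ^ (card V - card A)
      * (\<Sum>M\<in>perfect_matchings V. y ^ crossing M A)
    \<le> card (perfect_matchings V) * (p\<^sup>2 + 2 * y * p * q + q\<^sup>2) ^ (card V div 2)"
proof -
  let ?P = "perfect_matchings V" and ?B = "{B. B \<subseteq> V \<and> card B = card A}"
  have "real (card V choose card A) * p ^ card A * q ^ (card V - card A)
      * (\<Sum>M\<in>?P. y ^ crossing M A)
    = (\<Sum>B\<in>?B. p ^ card A * q ^ (card V - card A) * (\<Sum>M\<in>?P. y ^ crossing M A))"
    by (simp add: n_subsets[OF assms(1)])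
  also have "\<dots> = (\<Sum>B\<in>?B. p ^ card B * q ^ card (V - B) * (\<Sum>M\<in>?P. y ^ crossing M B))"
  proof (intro sum.cong refl)
    fix B assume B: "B \<in> ?B"
    then have "card (V - B) = card V - card A"
      using assms(1) by (auto simp: card_Diff_subset finite_subset)
    then show "p ^ card A * q ^ (card V - card A) * (\<Sum>M\<in>?P. y ^ crossing M A)
      = p ^ card B * q ^ card (V - B) * (\<Sum>M\<in>?P. y ^ crossing M B)"
      using B sum_crossing_card_eq[OF assms(1,2), of B "\<lambda>k. y ^ k"] by simp
  qed
  also have "\<dots> \<le> (\<Sum>B\<in>Pow V. p ^ card B * q ^ card (V - B) * (\<Sum>M\<in>?P. y ^ crossing M B))"
    using assms by (intro sum_mono2) (auto intro!: mult_nonneg_nonneg sum_nonneg)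
  also have "\<dots> = (\<Sum>M\<in>?P. \<Sum>B\<in>Pow V. p ^ card B * q ^ card (V - B) * y ^ crossing M B)"
    by (simp add: sum_distrib_left, rule sum.swap)
  also have "\<dots> = (\<Sum>M\<in>?P. (p\<^sup>2 + 2 * y * p * q + q\<^sup>2) ^ (card V div 2))"
  proof (intro sum.cong refl)
    fix M assume "M \<in> ?P"
    note M = perfect_matchingsD[OF this assms(1)]
    have "card M = card V div 2"
      using M(5) by simp
    then show "(\<Sum>B\<in>Pow V. p ^ card B * q ^ card (V - B) * y ^ crossing M B)
      = (p\<^sup>2 + 2 * y * p * q + q\<^sup>2) ^ (card V div 2)"
      using sum_Pow_pow_crossing[OF M(1,3), of p q y] M(2,4) by simp
  qed
  finally show ?thesis by simp
qed

section \<open>Large deviations of the crossing number\<close>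

text \<open>The terms of the expansion of \<open>(a + (N - a)) ^ N\<close> rise up to
  \<open>k = a\<close> and fall afterwards, as the cross-multiplied ratio of neighbouring terms
  shows.\<close>

lemma binomial_term_mode:
  fixes N a k :: nat
  assumes "a \<le> N" "k \<le> N"
  shows "real (N choose k) * real a ^ k * real (N - a) ^ (N - k)
    \<le> real (N choose a) * real a ^ a * real (N - a) ^ (N - a)"
proof -
  define t where "t k = (N choose k) * a ^ k * (N - a) ^ (N - k)" for k
  have step: "Suc k * (N - a) * t (Suc k) = (N - k) * a * t k" if "k < N" for k
  proof -
    have "Suc k * (N choose Suc k) = (N - k) * (N choose k)"
      by (simp only: binomial_absorb_comp binomial_absorption)
    moreover have "(N - a) ^ (N - k) = (N - a) * (N - a) ^ (N - Suc k)"
      using that by (metis Suc_diff_Suc power_Suc)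
    moreover have "Suc k * (N - a) * t (Suc k)
        = (Suc k * (N choose Suc k)) * (a * a ^ k) * ((N - a) * (N - a) ^ (N - Suc k))"
      unfolding t_def by (simp only: power_Suc mult_ac)
    ultimately have "Suc k * (N - a) * t (Suc k)
        = ((N - k) * (N choose k)) * (a * a ^ k) * (N - a) ^ (N - k)"
      by presburger
    then show ?thesis
      unfolding t_def by (simp only: mult_ac)
  qed
  have up: "t k \<le> t (Suc k)" if "k < a" for k
  proof (cases "a = N")
    case True
    \<comment> \<open>Here the factor \<open>N - a = 0\<close> cannot be cancelled, but
      \<open>t k\<close> vanishes because \<open>N - k > 0\<close>.\<close>
    then show ?thesis using that by (simp add: t_def power_0_left)
  next
    case False
    have "Suc k * (N - a) \<le> a * (N - k)"
      using that by (intro mult_mono) auto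
    then have "Suc k * (N - a) * t k \<le> Suc k * (N - a) * t (Suc k)"
      using step[of k] that assms by (simp add: mult.commute[of a])
    then show ?thesis
      using False assms by simp
  qed
  have down: "t (Suc k) \<le> t k" if "a \<le> k" "k < N" for k
  proof -
    have "a * (N - k) \<le> Suc k * (N - a)"
      using that by (intro mult_mono) auto
    then have "Suc k * (N - a) * t (Suc k) \<le> Suc k * (N - a) * t k"
      using step[of k] that by (simp add: mult.commute[of a])
    then show ?thesis
      using that by simp
  qed
  have "t k \<le> t a"
  proof (cases "k \<le> a")
    case True
    then show ?thesis
      by (induction k rule: inc_induct) (use up in \<open>auto intro: order_trans\<close>)
  next
    case False
    then have "a \<le> k" by simp
    then show ?thesis using assms(2)
      by (induction k rule: dec_induct) (auto intro: order_trans[OF down])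
  qed
  then show ?thesis
    unfolding t_def by (simp flip: of_nat_mult of_nat_power)
qed

text \<open>The \<open>N + 1\<close> binomial probabilities with success rate \<open>a / N\<close>
  sum to 1, and the one at \<open>a\<close> is the largest. Thus fixing the number of coloured
  points at its mean costs only a polynomial factor.\<close>

lemma binomial_mode_ge:
  fixes N a :: nat
  assumes "a \<le> N" "N > 0"
  shows "1 \<le> real (N + 1) * (real (N choose a) * (a / N) ^ a * (1 - a / N) ^ (N - a))"
proof -
  have q: "1 - real a / real N = real (N - a) / real N"
    using assms by (simp add: field_simps of_nat_diff)
  have "real N ^ N = (real a + real (N - a)) ^ N"
    using assms by (simp add: of_nat_diff)
  also have "\<dots> = (\<Sum>k\<le>N. real (N choose k) * real a ^ k * real (N - a) ^ (N - k))"
    by (rule binomial_ring)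
  also have "\<dots> \<le> (\<Sum>k\<le>N. real (N choose a) * real a ^ a * real (N - a) ^ (N - a))"
    by (intro sum_mono binomial_term_mode assms) auto
  also have "\<dots> = real (N + 1) * (real (N choose a) * real a ^ a * real (N - a) ^ (N - a))"
    by simp
  finally have "real N ^ N \<le> real (N + 1) * (real (N choose a) * real a ^ a * real (N - a) ^ (N - a))" .
  moreover have "real N ^ N = real N ^ a * real N ^ (N - a)"
    using assms by (simp flip: power_add)
  ultimately show ?thesis
    unfolding q power_divide using assms by (simp add: field_simps)
qed

text \<open>For \<open>0 \<le> r\<close> the left side is the mean of
  \<open>exp (-\<theta> * X)\<close> for a Bernoulli variable \<open>X\<close> of mean
  \<open>r\<close>. Hoeffding's lemma, with its constant 1/8, is applied to \<open>1 - X\<close> and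
  the result shifted by \<open>exp (-\<theta>)\<close>.\<close>

lemma bernoulli_mgf_le:
  fixes r \<theta> :: real
  assumes "r \<le> 1" "\<theta> \<ge> 0"
  shows "1 - r * (1 - exp (-\<theta>)) \<le> exp (\<theta>\<^sup>2 / 8 - \<theta> * r)"
proof -
  have pos: "0 < 1 + (1 - r) * (exp \<theta> - 1)"
    using assms by (intro add_pos_nonneg mult_nonneg_nonneg) auto
  have "ln (1 + (1 - r) * (exp \<theta> - 1)) \<le> \<theta>\<^sup>2 / 8 + \<theta> * (1 - r)"
    using Hoeffdings_lemma_aux[of \<theta> "1 - r"] assms by simp
  then have "1 + (1 - r) * (exp \<theta> - 1) \<le> exp (\<theta>\<^sup>2 / 8 + \<theta> * (1 - r))"
    using pos by (simp add: ln_le_cancel_iff[symmetric])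
  then have "exp (-\<theta>) * (1 + (1 - r) * (exp \<theta> - 1)) \<le> exp (-\<theta>) * exp (\<theta>\<^sup>2 / 8 + \<theta> * (1 - r))"
    by (intro mult_left_mono) auto
  also have "\<dots> = exp (\<theta>\<^sup>2 / 8 - \<theta> * r)"
    by (simp flip: exp_add add: algebra_simps)
  also have "exp (-\<theta>) * (1 + (1 - r) * (exp \<theta> - 1)) = 1 - r * (1 - exp (-\<theta>))"
    by (simp add: algebra_simps flip: exp_add)
  finally show ?thesis .
qed

text \<open>Colour each point independently with probability \<sigma>: each of the
  \<open>N / 2\<close> pairs is then split with probability
  \<open>2 * \<sigma> * (1 - \<sigma>)\<close>, and \<open>bernoulli_mgf_le\<close> applies to each.
  Passing to exactly \<open>card A\<close> coloured points costs the factor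
  \<open>N + 1\<close>.\<close>

lemma sum_exp_crossing_le:
  fixes \<theta> :: real
  assumes "finite V" "A \<subseteq> V" "V \<noteq> {}" "even (card V)" "\<theta> \<ge> 0"
  defines "N \<equiv> real (card V)" and "\<sigma> \<equiv> real (card A) / real (card V)"
  shows "(\<Sum>M\<in>perfect_matchings V. exp (-\<theta> * crossing M A))
    \<le> card (perfect_matchings V) * ((N + 1) * exp (N * (\<theta>\<^sup>2 / 16 - \<theta> * \<sigma> * (1 - \<sigma>))))"
proof -
  have card: "card A \<le> card V" "card V > 0"
    using assms by (auto simp: card_mono card_gt_0_iff)
  then have \<sigma>: "0 \<le> \<sigma>" "\<sigma> \<le> 1"
    unfolding \<sigma>_def by (auto simp: divide_simps)
  let ?S = "\<Sum>M\<in>perfect_matchings V. exp (-\<theta>) ^ crossing M A"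
  let ?b = "real (card V choose card A) * \<sigma> ^ card A * (1 - \<sigma>) ^ (card V - card A)"
  \<comment> \<open>The upper bound comes from
    \<open>\<sigma>\<^sup>2 + (1 - \<sigma>)\<^sup>2 \<ge> 0\<close>; it keeps the base of the power
    below nonnegative.\<close>
  have quad: "0 \<le> 2 * \<sigma> * (1 - \<sigma>)" "2 * \<sigma> * (1 - \<sigma>) \<le> 1"
    using \<sigma> by auto (use sum_squares_ge_zero[of \<sigma> "1 - \<sigma>"] in \<open>simp add: algebra_simps\<close>)
  have S0: "0 \<le> ?S"
    by (intro sum_nonneg) auto
  have "\<sigma>\<^sup>2 + 2 * exp (-\<theta>) * \<sigma> * (1 - \<sigma>) + (1 - \<sigma>)\<^sup>2 = 1 - 2 * \<sigma> * (1 - \<sigma>) * (1 - exp (-\<theta>))"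
    by (simp add: power2_eq_square algebra_simps)
  also have "\<dots> ^ (card V div 2) \<le> exp (\<theta>\<^sup>2 / 8 - \<theta> * (2 * \<sigma> * (1 - \<sigma>))) ^ (card V div 2)"
  proof (rule power_mono)
    have "2 * \<sigma> * (1 - \<sigma>) * (1 - exp (-\<theta>)) \<le> 1 * 1"
      by (intro mult_mono quad) (use assms in auto)
    then show "0 \<le> 1 - 2 * \<sigma> * (1 - \<sigma>) * (1 - exp (-\<theta>))" by simp
  qed (intro bernoulli_mgf_le quad assms)
  also have "\<dots> = exp (N * (\<theta>\<^sup>2 / 16 - \<theta> * \<sigma> * (1 - \<sigma>)))"
    using assms(4) unfolding N_def
    by (auto elim!: evenE simp flip: exp_of_nat_mult simp: algebra_simps)
  finally have pow: "(\<sigma>\<^sup>2 + 2 * exp (-\<theta>) * \<sigma> * (1 - \<sigma>) + (1 - \<sigma>)\<^sup>2) ^ (card V div 2)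
      \<le> exp (N * (\<theta>\<^sup>2 / 16 - \<theta> * \<sigma> * (1 - \<sigma>)))" .
  have "1 \<le> (N + 1) * ?b"
    using binomial_mode_ge[OF card] unfolding N_def \<sigma>_def by (simp add: add.commute)
  from mult_right_mono[OF this S0] have "?S \<le> (N + 1) * (?b * ?S)"
    by (simp add: mult.assoc)
  also have "\<dots> \<le> (N + 1) * (card (perfect_matchings V) *
      (\<sigma>\<^sup>2 + 2 * exp (-\<theta>) * \<sigma> * (1 - \<sigma>) + (1 - \<sigma>)\<^sup>2) ^ (card V div 2))"
    using \<sigma> by (intro mult_left_mono sum_pow_crossing_le assms) (auto simp: N_def)
  also have "\<dots> \<le> (N + 1) * (card (perfect_matchings V) * exp (N * (\<theta>\<^sup>2 / 16 - \<theta> * \<sigma> * (1 - \<sigma>))))"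
    using pow by (intro mult_left_mono) (auto simp: N_def)
  finally show ?thesis
    by (simp add: mult_ac flip: exp_of_nat_mult)
qed

text \<open>
  With \<open>\<sigma> = card A / card V\<close>, take \<open>q = 1\<close> and \<open>p = y = sqrt \<sigma>\<close> in the generating
  function bound \<open>sum_pow_crossing_le\<close>: when half of the points of \<open>A\<close> are paired inside \<open>A\<close>, these are the optimal
  orders of magnitude.
\<close>
lemma card_few_crossing_le:
  fixes c :: real
  assumes "finite V" "A \<subseteq> V" "A \<noteq> {}" "even (card V)" "c \<le> card A / 2"
  shows "card {M \<in> perfect_matchings V. crossing M A \<le> c}
    \<le> card (perfect_matchings V) * (exp 6 * card A / card V) powr (card A / 4)"
proof -
  define a where "a = card A"
  define \<sigma> where "\<sigma> = real a / card V"
  have card: "a \<le> card V" "a > 0" "card V > 0"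
    using assms card_mono[OF assms(1,2)] finite_subset[OF assms(2,1)]
    by (auto simp: a_def card_gt_0_iff)
  then have \<sigma>: "0 < \<sigma>" "\<sigma> \<le> 1"
    unfolding \<sigma>_def by (auto simp: divide_simps)
  define y where "y = sqrt \<sigma>"
  have y: "0 < y" "y \<le> 1" "y\<^sup>2 = \<sigma>"
    using \<sigma> unfolding y_def by auto
  let ?P = "perfect_matchings V"
  have yp: "y = \<sigma> powr (1/2)"
    unfolding y_def using \<sigma> by (simp add: powr_half_sqrt)
  have "card {M \<in> ?P. crossing M A \<le> c} * y powr (a / 2)
      = (\<Sum>M\<in>{M \<in> ?P. crossing M A \<le> c}. y powr (a / 2))"
    by simp
  \<comment> \<open>Markov's inequality: as \<open>y \<le> 1\<close>, a matching with at most
    \<open>a / 2\<close> crossings has weight at least \<open>y powr (a / 2)\<close>.\<close>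
  also have "\<dots> \<le> (\<Sum>M\<in>{M \<in> ?P. crossing M A \<le> c}. y ^ crossing M A)"
  proof (rule sum_mono)
    fix M assume "M \<in> {M \<in> ?P. crossing M A \<le> c}"
    then have "real (crossing M A) \<le> a / 2"
      using assms(5) by (auto simp: a_def)
    then have "y powr (a / 2) \<le> y powr (crossing M A)"
      using y by (intro powr_mono') auto
    then show "y powr (a / 2) \<le> y ^ crossing M A"
      using y by (simp add: powr_realpow)
  qed
  also have "\<dots> \<le> (\<Sum>M\<in>?P. y ^ crossing M A)"
    using y finite_perfect_matchings[OF assms(1)] by (intro sum_mono2) auto
  finally have "card {M \<in> ?P. crossing M A \<le> c} * y powr (a / 2) \<le> (\<Sum>M\<in>?P. y ^ crossing M A)" .
  then have "((card V / a) ^ a * y ^ a) * (card {M \<in> ?P. crossing M A \<le> c} * y powr (a / 2))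
     \<le> (real (card V choose a) * y ^ a) * (\<Sum>M\<in>?P. y ^ crossing M A)"
    using y card by (intro mult_mono binomial_ge_n_over_k_pow_k) auto
  also have "\<dots> \<le> card ?P * (y\<^sup>2 + 2 * y * y * 1 + 1\<^sup>2) ^ (card V div 2)"
    using sum_pow_crossing_le[OF assms(1,2), of y 1 y] y by (simp add: a_def)
  also have "\<dots> \<le> card ?P * exp (3 * \<sigma>) ^ (card V div 2)"
  proof (intro mult_left_mono power_mono)
    have "y\<^sup>2 + 2 * y * y * 1 + 1\<^sup>2 = 1 + 3 * \<sigma>"
      using y(3) by (simp add: power2_eq_square)
    also have "\<dots> \<le> exp (3 * \<sigma>)"
      by (rule exp_ge_add_one_self)
    finally show "y\<^sup>2 + 2 * y * y * 1 + 1\<^sup>2 \<le> exp (3 * \<sigma>)" .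
  qed (use y in auto)
  also have "exp (3 * \<sigma>) ^ (card V div 2) = exp (3 / 2 * a)"
    using assms(4) card unfolding \<sigma>_def by (auto elim!: evenE simp flip: exp_of_nat_mult)
  finally have main: "((card V / a) ^ a * y ^ a) * (card {M \<in> ?P. crossing M A \<le> c} * y powr (a / 2))
    \<le> card ?P * exp (3 / 2 * a)" .
  have e1: "(card V / a) ^ a = \<sigma> powr (- a)"
    using card \<sigma> by (simp add: \<sigma>_def powr_minus powr_realpow power_divide)
  have e2: "y ^ a = \<sigma> powr (a / 2)" "y powr (a / 2) = \<sigma> powr (a / 4)"
    using y \<sigma> by (simp_all add: yp powr_powr flip: powr_realpow)
  \<comment> \<open>The three powers of \<sigma> come from the number of sets, the weight
    \<open>p ^ a\<close> and Markov's inequality; the first wins by \<open>a / 4\<close>.\<close>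
  have "\<sigma> powr (- a) * \<sigma> powr (a / 2) * \<sigma> powr (a / 4) = \<sigma> powr (- (a / 4))"
    using \<sigma> by (simp flip: powr_add)
  moreover have "card {M \<in> ?P. crossing M A \<le> c} * (\<sigma> powr (- a) * \<sigma> powr (a / 2) * \<sigma> powr (a / 4))
      \<le> card ?P * exp (3 / 2 * a)"
    using main unfolding e1 e2 by (simp only: mult_ac)
  ultimately have "card {M \<in> ?P. crossing M A \<le> c} * \<sigma> powr (- (a / 4)) \<le> card ?P * exp (3 / 2 * a)"
    by simp
  then have "card {M \<in> ?P. crossing M A \<le> c} * \<sigma> powr (- (a / 4)) * \<sigma> powr (a / 4)
      \<le> card ?P * exp (3 / 2 * a) * \<sigma> powr (a / 4)"
    by (intro mult_right_mono) auto
  moreover have "\<sigma> powr (- (a / 4)) * \<sigma> powr (a / 4) = 1"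
    using \<sigma> by (simp flip: powr_add)
  \<comment> \<open>The constant \<open>exp 6\<close> arises from
    \<open>3 / 2 = 6 / 4\<close>.\<close>
  moreover have "exp (3 / 2 * a) * \<sigma> powr (a / 4) = (exp 6 * \<sigma>) powr (a / 4)"
    using \<sigma> by (simp add: powr_mult exp_powr_real)
  ultimately show ?thesis
    by (simp add: mult.assoc a_def \<sigma>_def)
qed

subsection \<open>Random flips and the partition function\<close>

text \<open>Signs turn symmetric difference into multiplication, so flipping a random set multiplies
  by independent random signs. Two vertices are separated by \<open>T\<close> exactly when their
  signs multiply to -1.\<close>

definition spin :: "'a set \<Rightarrow> 'a \<Rightarrow> real" where
  "spin T u = (if u \<in> T then - 1 else 1)"

lemma spin_sym_diff: "spin (sym_diff S T) u = spin S u * spin T u"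
  by (auto simp: spin_def)

lemma spin_square [simp]: "spin T u * spin T u = 1"
  by (simp add: spin_def)

lemma sum_spin:
  assumes "finite V" "T \<subseteq> V"
  shows "(\<Sum>u\<in>V. spin T u) = real (card V) - 2 * real (card T)"
proof -
  have "(\<Sum>u\<in>V. spin T u) = (\<Sum>u\<in>V. 1 - 2 * of_bool (u \<in> T))"
    by (intro sum.cong) (auto simp: spin_def)
  also have "\<dots> = real (card V) - 2 * real (card (V \<inter> T))"
    using assms by (simp add: sum_subtractf sum_distrib_left[symmetric] Int_def)
  finally show ?thesis
    using assms by (simp add: Int_absorb1)
qed

text \<open>The probability that a random subset of \<open>V\<close>, containing each element
  independently with probability \<epsilon>, equals \<open>D\<close>.\<close>

definition noise :: "real \<Rightarrow> 'a set \<Rightarrow> 'a set \<Rightarrow> real" where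
  "noise \<epsilon> V D = \<epsilon> ^ card D * (1 - \<epsilon>) ^ card (V - D)"

text \<open>The signs are independent with mean \<open>1 - 2 * \<epsilon>\<close>: attaching each
  sign to the weight of its flipped vertex turns the sum into an expanded product over
  \<open>V\<close>. Taking \<open>U\<close> empty, a singleton or a pair gives all moments used
  below.\<close>

lemma sum_noise_prod_spin:
  assumes "finite V" "U \<subseteq> V"
  shows "(\<Sum>D\<in>Pow V. noise \<epsilon> V D * (\<Prod>u\<in>U. spin D u)) = (1 - 2 * \<epsilon>) ^ card U"
proof -
  let ?s = "\<lambda>u. if u \<in> U then - 1 else (1::real)"
  have fU: "finite U"
    using assms by (rule finite_subset[rotated])
  have "(\<Sum>D\<in>Pow V. noise \<epsilon> V D * (\<Prod>u\<in>U. spin D u))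
      = (\<Sum>D\<in>Pow V. (\<Prod>u\<in>D. \<epsilon> * ?s u) * (\<Prod>u\<in>V - D. 1 - \<epsilon>))"
  proof (intro sum.cong refl)
    fix D assume "D \<in> Pow V"
    then have fD: "finite D"
      using assms by (auto intro: finite_subset)
    have "(\<Prod>u\<in>U. spin D u) = (- 1) ^ card (U \<inter> D)"
      using fU by (simp add: spin_def prod.If_cases)
    also have "\<dots> = (\<Prod>u\<in>D. ?s u)"
      using fD by (simp add: prod.If_cases Int_commute)
    finally show "noise \<epsilon> V D * (\<Prod>u\<in>U. spin D u) = (\<Prod>u\<in>D. \<epsilon> * ?s u) * (\<Prod>u\<in>V - D. 1 - \<epsilon>)"
      by (simp add: noise_def prod.distrib)
  qed
  also have "\<dots> = (\<Prod>u\<in>V. \<epsilon> * ?s u + (1 - \<epsilon>))"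
    by (rule prod_add[OF assms(1), symmetric])
  also have "\<dots> = (\<Prod>u\<in>V. if u \<in> U then 1 - 2 * \<epsilon> else 1)"
    by (intro prod.cong) auto
  also have "\<dots> = (1 - 2 * \<epsilon>) ^ card U"
    using assms by (simp add: prod.If_cases Int_absorb1)
  finally show ?thesis .
qed

lemma sum_noise:
  assumes "finite V"
  shows "(\<Sum>D\<in>Pow V. noise \<epsilon> V D) = 1"
  using sum_noise_prod_spin[OF assms, of "{}" \<epsilon>] by simp

lemma sum_noise_spin_mult:
  assumes "finite V" "u \<in> V" "v \<in> V"
  shows "(\<Sum>D\<in>Pow V. noise \<epsilon> V D * (spin D u * spin D v)) = (if u = v then 1 else (1 - 2 * \<epsilon>)\<^sup>2)"
  using sum_noise_prod_spin[OF assms(1), of "{u, v}" \<epsilon>] sum_noise[OF assms(1), of \<epsilon>] assms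
  by (auto simp: card_insert_if power2_eq_square)

lemma sum_noise_card:
  assumes "finite V"
  shows "(\<Sum>D\<in>Pow V. noise \<epsilon> V D * card D) = \<epsilon> * card V"
proof -
  have "(\<Sum>D\<in>Pow V. noise \<epsilon> V D * card D)
      = (\<Sum>D\<in>Pow V. \<Sum>u\<in>V. (noise \<epsilon> V D - noise \<epsilon> V D * spin D u) / 2)"
  proof (intro sum.cong refl)
    fix D assume "D \<in> Pow V"
    then have "real (card D) = (card V - (\<Sum>u\<in>V. spin D u)) / 2"
      using sum_spin[OF assms, of D] by simp
    also have "\<dots> = (\<Sum>u\<in>V. (1 - spin D u) / 2)"
      by (simp add: sum_subtractf flip: sum_divide_distrib)
    finally show "noise \<epsilon> V D * card D = (\<Sum>u\<in>V. (noise \<epsilon> V D - noise \<epsilon> V D * spin D u) / 2)"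
      by (simp add: sum_distrib_left right_diff_distrib)
  qed
  also have "\<dots> = (\<Sum>u\<in>V. ((\<Sum>D\<in>Pow V. noise \<epsilon> V D) - (\<Sum>D\<in>Pow V. noise \<epsilon> V D * spin D u)) / 2)"
    by (subst sum.swap) (simp add: sum_subtractf flip: sum_divide_distrib)
  also have "\<dots> = (\<Sum>u\<in>V. \<epsilon>)"
  proof (intro sum.cong refl)
    fix u assume "u \<in> V"
    then show "((\<Sum>D\<in>Pow V. noise \<epsilon> V D) - (\<Sum>D\<in>Pow V. noise \<epsilon> V D * spin D u)) / 2 = \<epsilon>"
      using sum_noise[OF assms, of \<epsilon>] sum_noise_prod_spin[OF assms, of "{u}" \<epsilon>] by simp
  qed
  finally show ?thesis by simp
qed

section \<open>The energy and its mean under random flips\<close>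

definition cell_points :: "nat \<Rightarrow> nat \<Rightarrow> nat set \<Rightarrow> nat set" where
  "cell_points d n S = {p. p < d * n \<and> p div d \<in> S}"

lemma cell_points_subset: "cell_points d n S \<subseteq> {..<d * n}"
  by (auto simp: cell_points_def)

lemma card_cell_points:
  assumes "S \<subseteq> {..<n}"
  shows "card (cell_points d n S) = d * card S"
proof (cases "d = 0")
  case False
  have fin: "finite S"
    using assms by (rule finite_subset) simp
  have "bij_betw (\<lambda>(k, r). k * d + r) (S \<times> {..<d}) (cell_points d n S)"
  proof (rule bij_betwI[where g = "\<lambda>p. (p div d, p mod d)"])
    have "k * d + r < d * n" if "k \<in> S" "r < d" for k r
    proof -
      have "k * d + r < (k + 1) * d" using that by simp
      also have "\<dots> \<le> n * d" using that assms by (intro mult_right_mono) auto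
      finally show ?thesis by (simp add: mult.commute)
    qed
    then show "(\<lambda>(k, r). k * d + r) \<in> S \<times> {..<d} \<rightarrow> cell_points d n S"
      by (auto simp: cell_points_def)
  qed (use False in \<open>auto simp: cell_points_def\<close>)
  then show ?thesis
    using bij_betw_same_card[of _ "S \<times> {..<d}" "cell_points d n S"]
    by (simp add: card_cartesian_product mult.commute)
qed (simp add: cell_points_def)

text \<open>A pair is split exactly when its two signs multiply to -1. This makes the crossing
  number a polynomial of degree two in the signs, whose mean under flips can be computed.\<close>

lemma crossing_eq_sum_spin:
  assumes "M \<in> perfect_matchings {..<d * n}"
  shows "real (crossing M (cell_points d n T)) = (\<Sum>e\<in>M. (1 - (\<Prod>p\<in>e. spin T (p div d))) / 2)"
proof -
  note M = perfect_matchingsD[OF assms finite_lessThan]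
  have "(1 - (\<Prod>p\<in>e. spin T (p div d))) / 2 = of_bool (card (e \<inter> cell_points d n T) = 1)"
    if "e \<in> M" for e
  proof -
    have "card e = 2" "e \<subseteq> {..<d * n}"
      using M(4)[OF that] by auto
    then obtain a b where e: "e = {a, b}" "a \<noteq> b" and "a < d * n" "b < d * n"
      by (auto simp: card_2_iff)
    from \<open>a < d * n\<close> \<open>b < d * n\<close> have "e \<inter> cell_points d n T = (if a div d \<in> T then {a} else {}) \<union> (if b div d \<in> T then {b} else {})"
      using e by (auto simp: cell_points_def)
    then show ?thesis
      using e by (auto simp: spin_def)
  qed
  then have "(\<Sum>e\<in>M. (1 - (\<Prod>p\<in>e. spin T (p div d))) / 2)
      = (\<Sum>e\<in>M. of_bool (card (e \<inter> cell_points d n T) = 1))"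
    by (intro sum.cong) auto
  then show ?thesis
    using M(1) by (simp add: crossing_def Int_def)
qed

text \<open>
  The mean of the crossing number is about \<open>d * n / 4 * (1 - \<mu>\<^sup>2)\<close>, where \<open>\<mu>\<close> is the average spin;
  the second summand of the energy, \<open>d * n / 4 * \<mu>\<^sup>2\<close>, cancels this dependence on \<open>T\<close>.
\<close>
definition energy :: "nat \<Rightarrow> nat \<Rightarrow> nat set set \<Rightarrow> nat set \<Rightarrow> real" where
  "energy d n M T = crossing M (cell_points d n T) + d / (4 * real n) * (\<Sum>u<n. spin T u)\<^sup>2"

text \<open>Flipping multiplies the mean of a product of signs at distinct vertices by \<rho>, so
  the energy relaxes towards its value for random signs. Of that value, \<open>d * n / 4\<close>
  comes from the \<open>d * n / 2\<close> pairs and the extra \<open>d / 4\<close> from the diagonal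
  of the squared imbalance.\<close>

lemma sum_noise_energy_le:
  fixes \<epsilon> :: real
  assumes M: "M \<in> perfect_matchings {..<d * n}" and "n > 0" "0 \<le> \<epsilon>" "\<epsilon> \<le> 1"
  defines "\<rho> \<equiv> (1 - 2 * \<epsilon>)\<^sup>2"
  shows "(\<Sum>D\<in>Pow {..<n}. noise \<epsilon> {..<n} D * energy d n M (sym_diff S D))
    \<le> \<rho> * energy d n M S + (1 - \<rho>) * (real d * real n + real d) / 4"
proof -
  let ?V = "{..<n}" and ?w = "noise \<epsilon> {..<n}"
  note M' = perfect_matchingsD[OF M finite_lessThan]
  have \<rho>: "0 \<le> \<rho>" "\<rho> \<le> 1"
    using assms unfolding \<rho>_def by (auto simp: abs_square_le_1)
  have w1: "(\<Sum>D\<in>Pow ?V. ?w D) = 1"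
    by (rule sum_noise) simp
  have w2: "(\<Sum>D\<in>Pow ?V. ?w D * (spin D u * spin D v)) = (if u = v then 1 else \<rho>)"
    if "u < n" "v < n" for u v
    unfolding \<rho>_def using that by (intro sum_noise_spin_mult) auto
  have "(\<Sum>D\<in>Pow ?V. ?w D * crossing M (cell_points d n (sym_diff S D)))
      = (\<Sum>e\<in>M. \<Sum>D\<in>Pow ?V. ?w D * ((1 - (\<Prod>p\<in>e. spin (sym_diff S D) (p div d))) / 2))"
    unfolding crossing_eq_sum_spin[OF M] sum_distrib_left by (rule sum.swap)
  also have "\<dots> \<le> (\<Sum>e\<in>M. \<rho> * ((1 - (\<Prod>p\<in>e. spin S (p div d))) / 2) + (1 - \<rho>) / 2)"
  proof (rule sum_mono)
    fix e assume "e \<in> M"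
    then have "card e = 2" "e \<subseteq> {..<d * n}"
      using M'(4)[of e] by auto
    then obtain a b where e: "e = {a, b}" "a \<noteq> b" and "a < d * n" "b < d * n"
      by (auto simp: card_2_iff)
    define u v where "u = a div d" and "v = b div d"
    have uv: "u < n" "v < n"
      unfolding u_def v_def using \<open>a < d * n\<close> \<open>b < d * n\<close> by (auto simp: less_mult_imp_div_less mult.commute)
    have "(\<Sum>D\<in>Pow ?V. ?w D * ((1 - (\<Prod>p\<in>e. spin (sym_diff S D) (p div d))) / 2))
        = (\<Sum>D\<in>Pow ?V. ?w D / 2 - spin S u * spin S v / 2 * (?w D * (spin D u * spin D v)))"
      using e by (intro sum.cong) (auto simp: spin_sym_diff u_def v_def field_simps)
    also have "\<dots> = 1 / 2 - spin S u * spin S v / 2 * (if u = v then 1 else \<rho>)"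
      using w1 w2[OF uv] by (simp add: sum_subtractf flip: sum_distrib_left sum_divide_distrib)
    \<comment> \<open>Equality for \<open>u \<noteq> v\<close>. A loop is never cut, so for
      \<open>u = v\<close> the left side is 0.\<close>
    also have "\<dots> \<le> \<rho> * ((1 - spin S u * spin S v) / 2) + (1 - \<rho>) / 2"
      using \<rho> by (auto simp: field_simps)
    finally show "(\<Sum>D\<in>Pow ?V. ?w D * ((1 - (\<Prod>p\<in>e. spin (sym_diff S D) (p div d))) / 2))
        \<le> \<rho> * ((1 - (\<Prod>p\<in>e. spin S (p div d))) / 2) + (1 - \<rho>) / 2"
      using e by (simp add: u_def v_def)
  qed
  also have "\<dots> = \<rho> * crossing M (cell_points d n S) + (1 - \<rho>) / 2 * card M"
    unfolding crossing_eq_sum_spin[OF M] by (simp add: sum.distrib sum_distrib_left)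
  also have "real (card M) = real d * real n / 2"
    using M'(5) by (simp flip: of_nat_mult)
  finally have cross: "(\<Sum>D\<in>Pow ?V. ?w D * crossing M (cell_points d n (sym_diff S D)))
      \<le> \<rho> * crossing M (cell_points d n S) + (1 - \<rho>) / 2 * (real d * real n / 2)" .
  have "(\<Sum>D\<in>Pow ?V. ?w D * (\<Sum>u<n. spin (sym_diff S D) u)\<^sup>2)
      = (\<Sum>D\<in>Pow ?V. \<Sum>u<n. \<Sum>v<n. spin S u * spin S v * (?w D * (spin D u * spin D v)))"
    by (simp add: power2_eq_square sum_product sum_distrib_left spin_sym_diff mult_ac)
  also have "\<dots> = (\<Sum>u<n. \<Sum>v<n. spin S u * spin S v * (\<Sum>D\<in>Pow ?V. ?w D * (spin D u * spin D v)))"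
    by (subst sum.swap, subst sum.swap) (simp add: sum_distrib_left)
  also have "\<dots> = (\<Sum>u<n. \<Sum>v<n. \<rho> * (spin S u * spin S v) + (if u = v then 1 - \<rho> else 0))"
  proof (intro sum.cong refl)
    fix u v assume "u \<in> {..<n}" "v \<in> {..<n}"
    then show "spin S u * spin S v * (\<Sum>D\<in>Pow ?V. ?w D * (spin D u * spin D v))
      = \<rho> * (spin S u * spin S v) + (if u = v then 1 - \<rho> else 0)"
      using w2[of u v] by auto
  qed
  also have "\<dots> = \<rho> * (\<Sum>u<n. spin S u)\<^sup>2 + n * (1 - \<rho>)"
    unfolding power2_eq_square sum_product by (simp add: sum.distrib sum_distrib_left)
  finally have sq: "(\<Sum>D\<in>Pow ?V. ?w D * (\<Sum>u<n. spin (sym_diff S D) u)\<^sup>2)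
      = \<rho> * (\<Sum>u<n. spin S u)\<^sup>2 + n * (1 - \<rho>)" .
  have "(\<Sum>D\<in>Pow ?V. ?w D * energy d n M (sym_diff S D))
      = (\<Sum>D\<in>Pow ?V. ?w D * crossing M (cell_points d n (sym_diff S D)))
        + d / (4 * real n) * (\<Sum>D\<in>Pow ?V. ?w D * (\<Sum>u<n. spin (sym_diff S D) u)\<^sup>2)"
    unfolding energy_def by (simp only: distrib_left sum.distrib sum_distrib_left mult_ac)
  also have "\<dots> \<le> \<rho> * crossing M (cell_points d n S) + (1 - \<rho>) / 2 * (real d * real n / 2)
      + d / (4 * real n) * (\<rho> * (\<Sum>u<n. spin S u)\<^sup>2 + n * (1 - \<rho>))"
    unfolding sq using cross by simp
  also have "\<dots> = \<rho> * energy d n M S + (1 - \<rho>) * (real d * real n + real d) / 4"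
    unfolding energy_def using \<open>n > 0\<close> by (simp add: field_simps)
  finally show ?thesis .
qed

section \<open>Jensen's inequality for the partition function\<close>

lemma sum_Pow_sym_diff:
  assumes "S \<subseteq> V"
  shows "(\<Sum>T\<in>Pow V. f T) = (\<Sum>D\<in>Pow V. f (sym_diff S D))"
  by (rule sum.reindex_bij_witness[of _ "sym_diff S" "sym_diff S"])
     (use assms in \<open>auto intro!: arg_cong[of _ _ f]\<close>)

text \<open>The variational lower bound for a partition function, tested with the law of
  \<open>S\<close> after random flips. Its entropy is at least
  \<open>n * \<epsilon> * ln (1 / \<epsilon>)\<close> because \<open>noise\<close> is at most
  \<open>\<epsilon> ^ card D\<close>; its mean energy is bounded by
  \<open>sum_noise_energy_le\<close>.\<close>

lemma partition_function_ge:
  fixes \<epsilon> \<theta> :: real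
  assumes M: "M \<in> perfect_matchings {..<d * n}" and S: "S \<subseteq> {..<n}"
    and "n > 0" "0 < \<epsilon>" "\<epsilon> < 1" "\<theta> \<ge> 0"
  defines "\<rho> \<equiv> (1 - 2 * \<epsilon>)\<^sup>2"
  shows "exp (n * \<epsilon> * ln (1 / \<epsilon>) - \<theta> * (\<rho> * energy d n M S + (1 - \<rho>) * (real d * real n + real d) / 4))
    \<le> (\<Sum>T\<in>Pow {..<n}. exp (- \<theta> * energy d n M T))"
proof -
  let ?V = "{..<n}" and ?w = "noise \<epsilon> {..<n}"
  define m where
    "m = n * \<epsilon> * ln (1 / \<epsilon>) - \<theta> * (\<rho> * energy d n M S + (1 - \<rho>) * (real d * real n + real d) / 4)"
  define E where "E D = energy d n M (sym_diff S D)" for D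
  \<comment> \<open>Chosen so that \<open>?w D * exp (x D)\<close> is at most the weight
    \<open>exp (- \<theta> * E D)\<close>.\<close>
  define x where "x D = ln (1 / \<epsilon>) * card D - \<theta> * E D" for D
  have "m \<le> ln (1 / \<epsilon>) * (\<Sum>D\<in>Pow ?V. ?w D * card D) - \<theta> * (\<Sum>D\<in>Pow ?V. ?w D * E D)"
    using mult_left_mono[OF sum_noise_energy_le[OF M \<open>n > 0\<close>, of \<epsilon> S] \<open>\<theta> \<ge> 0\<close>] assms
    unfolding m_def E_def \<rho>_def sum_noise_card[OF finite_lessThan] by (simp add: mult_ac)
  also have "\<dots> = (\<Sum>D\<in>Pow ?V. ?w D * x D)"
    unfolding x_def by (simp add: sum_distrib_left right_diff_distrib sum_subtractf mult_ac)
  finally have mean: "m \<le> (\<Sum>D\<in>Pow ?V. ?w D * x D)" .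
  \<comment> \<open>Jensen in tangent form: \<open>exp (x D)\<close> lies above the tangent of
    \<open>exp\<close> at \<open>m\<close>, and that tangent averages to at least
    \<open>exp m\<close> because \<open>x D\<close> has mean at least \<open>m\<close>.\<close>
  have "exp m \<le> exp m * ((\<Sum>D\<in>Pow ?V. ?w D * x D) + (1 - m) * (\<Sum>D\<in>Pow ?V. ?w D))"
    using mean by (simp add: sum_noise)
  also have "\<dots> = (\<Sum>D\<in>Pow ?V. ?w D * (exp m * (1 + (x D - m))))"
    by (simp add: sum_distrib_left flip: sum.distrib) (simp add: algebra_simps)
  also have "\<dots> \<le> (\<Sum>D\<in>Pow ?V. exp (- \<theta> * E D))"
  proof (rule sum_mono)
    fix D
    have w0: "0 \<le> ?w D"
      using assms by (simp add: noise_def)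
    have "?w D \<le> \<epsilon> ^ card D * 1"
      unfolding noise_def using assms by (intro mult_left_mono power_le_one) auto
    also have "\<epsilon> ^ card D = exp (- ln (1 / \<epsilon>) * card D)"
      using assms by (simp add: ln_div mult.commute[of "ln \<epsilon>"] exp_of_nat_mult)
    finally have w: "?w D \<le> exp (- ln (1 / \<epsilon>) * card D)" by simp
    have "?w D * (exp m * (1 + (x D - m))) \<le> ?w D * (exp m * exp (x D - m))"
      by (intro mult_left_mono exp_ge_add_one_self w0) auto
    also have "\<dots> = ?w D * exp (x D)"
      by (simp flip: exp_add)
    also have "\<dots> \<le> exp (- ln (1 / \<epsilon>) * card D) * exp (x D)"
      using w by (rule mult_right_mono) simp
    also have "\<dots> = exp (- \<theta> * E D)"
      unfolding x_def by (simp flip: exp_add)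
    finally show "?w D * (exp m * (1 + (x D - m))) \<le> exp (- \<theta> * E D)" .
  qed
  also have "\<dots> = (\<Sum>T\<in>Pow ?V. exp (- \<theta> * energy d n M T))"
    unfolding E_def by (rule sum_Pow_sym_diff[OF S, symmetric])
  finally show ?thesis unfolding m_def .
qed

subsection \<open>Sparse cuts\<close>

text \<open>In units of \<open>d * n / 4\<close>, and with \<mu> the average sign, the two parts of
  the energy are at most \<open>(1 - \<eta>) * (1 - \<mu>)\<close> and \<open>\<mu>\<^sup>2\<close>.
  The size bounds say \<open>0 \<le> \<mu> \<le> 1 - \<eta>\<close>, so
  \<open>\<mu>\<^sup>2 \<le> \<mu> * (1 - \<eta>)\<close> and the two add up to at most
  \<open>1 - \<eta>\<close>.\<close>

lemma energy_le_of_sparse_cut: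
  fixes \<eta> :: real
  assumes "S \<subseteq> {..<n}" "n > 0" "2 * card S \<le> n" "\<eta> * n / 2 \<le> card S"
    and cut: "crossing M (cell_points d n S) \<le> (1 - \<eta>) * (d / 2) * card S"
  shows "energy d n M S \<le> real d * real n / 4 * (1 - \<eta>)"
proof -
  define \<mu> where "\<mu> = 1 - 2 * card S / n"
  have s: "real (card S) = (1 - \<mu>) / 2 * n"
    using assms(2) by (simp add: \<mu>_def field_simps)
  have "0 \<le> \<mu>" "\<mu> \<le> 1 - \<eta>"
    using assms(2,3,4) by (auto simp: \<mu>_def field_simps)
  then have \<mu>: "\<mu>\<^sup>2 \<le> \<mu> * (1 - \<eta>)"
    by (simp add: power2_eq_square mult_left_mono)
  have "(\<Sum>u<n. spin S u) = \<mu> * n"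
    using sum_spin[OF finite_lessThan assms(1)] s by (simp add: field_simps)
  then have "energy d n M S \<le> (1 - \<eta>) * (d / 2) * ((1 - \<mu>) / 2 * n) + d / (4 * real n) * (\<mu> * n)\<^sup>2"
    unfolding energy_def using cut unfolding s by simp
  also have "\<dots> = real d * real n / 4 * ((1 - \<eta>) * (1 - \<mu>) + \<mu>\<^sup>2)"
    using assms(2) by (simp add: field_simps power2_eq_square)
  also have "\<dots> \<le> real d * real n / 4 * (1 - \<eta>)"
    using \<mu> by (intro mult_left_mono) (auto simp: algebra_simps)
  finally show ?thesis .
qed

text \<open>The imbalance term of the energy equals
  \<open>d * n * (1 / 4 - \<sigma> * (1 - \<sigma>))\<close>, which exactly offsets the dependence
  on \<sigma> in \<open>sum_exp_crossing_le\<close>.\<close>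

lemma sum_exp_energy_le:
  fixes \<theta> :: real
  assumes "T \<subseteq> {..<n}" "d > 0" "n > 0" "even (d * n)" "\<theta> \<ge> 0"
  shows "(\<Sum>M\<in>perfect_matchings {..<d * n}. exp (-\<theta> * energy d n M T))
    \<le> card (perfect_matchings {..<d * n}) *
      ((real d * real n + 1) * exp (real d * real n * (\<theta>\<^sup>2 / 16 - \<theta> / 4)))"
proof -
  define \<sigma> where "\<sigma> = real (card T) / n"
  define c where "c = d / (4 * real n) * (\<Sum>u<n. spin T u)\<^sup>2"
  have sum: "(\<Sum>u<n. spin T u) = n * (1 - 2 * \<sigma>)"
    unfolding sum_spin[OF finite_lessThan assms(1)] using assms(3)
    by (simp add: \<sigma>_def right_diff_distrib)
  have c: "c = real d * real n * (1 / 4 - \<sigma> * (1 - \<sigma>))"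
    unfolding c_def sum using assms(3) by (simp add: field_simps power2_eq_square)
  have ne: "{..<d * n} \<noteq> {}"
    using assms(2,3) by (simp add: lessThan_empty_iff)
  have \<sigma>: "real (card (cell_points d n T)) / real (card {..<d * n}) = \<sigma>"
    using assms(2) by (simp add: card_cell_points[OF assms(1)] \<sigma>_def)
  have "(\<Sum>M\<in>perfect_matchings {..<d * n}. exp (-\<theta> * energy d n M T))
    = exp (-\<theta> * c) * (\<Sum>M\<in>perfect_matchings {..<d * n}. exp (-\<theta> * crossing M (cell_points d n T)))"
    unfolding sum_distrib_left by (intro sum.cong) (auto simp: energy_def c_def algebra_simps simp flip: exp_add)
  also have "\<dots> \<le> exp (-\<theta> * c) * (card (perfect_matchings {..<d * n}) *
      ((real d * real n + 1) * exp (real d * real n * (\<theta>\<^sup>2 / 16 - \<theta> * \<sigma> * (1 - \<sigma>)))))"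
    using sum_exp_crossing_le[OF finite_lessThan cell_points_subset[of d n T] ne _ assms(5)] assms(4)
    unfolding \<sigma> by (intro mult_left_mono) simp_all
  also have "\<dots> = card (perfect_matchings {..<d * n}) * ((real d * real n + 1) *
      (exp (-\<theta> * c) * exp (real d * real n * (\<theta>\<^sup>2 / 16 - \<theta> * \<sigma> * (1 - \<sigma>)))))"
    by (simp only: mult_ac)
  also have "exp (-\<theta> * c) * exp (real d * real n * (\<theta>\<^sup>2 / 16 - \<theta> * \<sigma> * (1 - \<sigma>)))
      = exp (real d * real n * (\<theta>\<^sup>2 / 16 - \<theta> / 4))"
    unfolding c exp_add[symmetric] by (simp add: algebra_simps)
  finally show ?thesis .
qed

text \<open>Markov's inequality for the partition function: one sparse cut forces it above
  \<open>exp m\<close>, while its mean is at most \<open>2 ^ n\<close> times the uniform bound of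
  \<open>sum_exp_energy_le\<close>. Compared with a union bound over sets, the exponent gains
  \<open>\<epsilon> * ln (1 / \<epsilon>)\<close> and loses only the factor
  \<open>\<rho>\<^sup>2\<close> in \<open>\<eta>\<^sup>2 * d / 4\<close>.\<close>

lemma card_sparse_large_cut_le:
  fixes \<epsilon> \<eta> :: real
  assumes "d > 0" "n > 0" "even (d * n)" "0 < \<epsilon>" "\<epsilon> < 1" "\<eta> \<ge> 0"
  defines "P \<equiv> perfect_matchings {..<d * n}" and "\<rho> \<equiv> (1 - 2 * \<epsilon>)\<^sup>2"
  shows "card {M \<in> P. \<exists>S\<subseteq>{..<n}. 2 * card S \<le> n \<and> \<eta> * n / 2 \<le> card S \<and>
      crossing M (cell_points d n S) \<le> (1 - \<eta>) * (d / 2) * card S}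
    \<le> card P * ((real d * real n + 1) * exp (\<rho> * (1 - \<rho>) * \<eta> * d / 2) *
        exp (n * (ln 2 - \<epsilon> * ln (1 / \<epsilon>) - \<rho>\<^sup>2 * \<eta>\<^sup>2 * d / 4)))"
proof -
  let ?N = "real d * real n"
  let ?B = "{M \<in> P. \<exists>S\<subseteq>{..<n}. 2 * card S \<le> n \<and> \<eta> * n / 2 \<le> card S \<and>
      crossing M (cell_points d n S) \<le> (1 - \<eta>) * (d / 2) * card S}"
  \<comment> \<open>Minimises \<open>\<theta>\<^sup>2 / 16 - \<theta> * \<rho> * \<eta> / 4\<close>,
    the coefficient of \<open>d * n\<close> that remains in the exponent.\<close>
  define \<theta> where "\<theta> = 2 * \<rho> * \<eta>"
  define m where "m = n * \<epsilon> * ln (1 / \<epsilon>) - \<theta> * (\<rho> * (?N / 4 * (1 - \<eta>)) + (1 - \<rho>) * (?N + real d) / 4)"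
  have \<theta>: "\<theta> \<ge> 0" and \<rho>: "\<rho> \<ge> 0"
    using assms by (auto simp: \<theta>_def \<rho>_def)
  have finP: "finite P"
    unfolding P_def by (rule finite_perfect_matchings) simp
  have "card ?B * exp m = (\<Sum>M\<in>?B. exp m)"
    by simp
  also have "\<dots> \<le> (\<Sum>M\<in>?B. \<Sum>T\<in>Pow {..<n}. exp (- \<theta> * energy d n M T))"
  proof (rule sum_mono)
    fix M assume "M \<in> ?B"
    then obtain S where M: "M \<in> perfect_matchings {..<d * n}" and S: "S \<subseteq> {..<n}"
      and E: "energy d n M S \<le> ?N / 4 * (1 - \<eta>)"
      using energy_le_of_sparse_cut[OF _ assms(2)] unfolding P_def by blast
    have "\<rho> * energy d n M S + (1 - \<rho>) * (?N + real d) / 4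
        \<le> \<rho> * (?N / 4 * (1 - \<eta>)) + (1 - \<rho>) * (?N + real d) / 4"
      using \<rho> E by (intro add_right_mono mult_left_mono)
    from mult_left_mono[OF this \<theta>]
    have "m \<le> n * \<epsilon> * ln (1 / \<epsilon>) - \<theta> * (\<rho> * energy d n M S + (1 - \<rho>) * (?N + real d) / 4)"
      unfolding m_def by linarith
    then show "exp m \<le> (\<Sum>T\<in>Pow {..<n}. exp (- \<theta> * energy d n M T))"
      using partition_function_ge[OF M S assms(2,4,5) \<theta>] unfolding \<rho>_def
      by (meson exp_le_cancel_iff order_trans)
  qed
  also have "\<dots> \<le> (\<Sum>M\<in>P. \<Sum>T\<in>Pow {..<n}. exp (- \<theta> * energy d n M T))"
    using finP by (intro sum_mono2) (auto intro: sum_nonneg)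
  also have "\<dots> = (\<Sum>T\<in>Pow {..<n}. \<Sum>M\<in>P. exp (- \<theta> * energy d n M T))"
    by (rule sum.swap)
  also have "\<dots> \<le> (\<Sum>T\<in>Pow {..<n}. card P * ((?N + 1) * exp (?N * (\<theta>\<^sup>2 / 16 - \<theta> / 4))))"
    unfolding P_def by (intro sum_mono sum_exp_energy_le assms \<theta>) auto
  also have "\<dots> = card P * ((?N + 1) * (exp (n * ln 2) * exp (?N * (\<theta>\<^sup>2 / 16 - \<theta> / 4))))"
    by (simp add: card_Pow exp_of_nat_mult)
  finally have "card ?B * exp m * exp (- m)
      \<le> card P * ((?N + 1) * (exp (n * ln 2) * exp (?N * (\<theta>\<^sup>2 / 16 - \<theta> / 4)))) * exp (- m)"
    by (rule mult_right_mono) simp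
  also have "card ?B * exp m * exp (- m) = card ?B"
    by (simp add: exp_minus)
  also have "card P * ((?N + 1) * (exp (n * ln 2) * exp (?N * (\<theta>\<^sup>2 / 16 - \<theta> / 4)))) * exp (- m)
      = card P * ((?N + 1) * exp (n * ln 2 + ?N * (\<theta>\<^sup>2 / 16 - \<theta> / 4) - m))"
    by (simp only: exp_add diff_conv_add_uminus mult_ac)
  also have "n * ln 2 + ?N * (\<theta>\<^sup>2 / 16 - \<theta> / 4) - m
      = \<rho> * (1 - \<rho>) * \<eta> * d / 2 + n * (ln 2 - \<epsilon> * ln (1 / \<epsilon>) - \<rho>\<^sup>2 * \<eta>\<^sup>2 * d / 4)"
    unfolding m_def \<theta>_def by (simp add: power2_eq_square field_simps)
  finally show ?thesis
    by (simp add: exp_add mult.assoc)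
qed

section \<open>A union bound for small sets\<close>

text \<open>A single term of the expansion of \<open>(s / n + 1) ^ n\<close> is at most the whole,
  which is at most \<open>exp s\<close>.\<close>

lemma binomial_le_exp_pow:
  assumes "s > 0" "n > 0"
  shows "real (n choose s) \<le> (exp 1 * n / s) ^ s"
proof (cases "s \<le> n")
  case True
  have "real (n choose s) * (s / n) ^ s \<le> (\<Sum>k\<le>n. real (n choose k) * (s / n) ^ k * 1 ^ (n - k))"
    using member_le_sum[of s "{..n}" "\<lambda>k. real (n choose k) * (s / n) ^ k * 1 ^ (n - k)"] True by simp
  also have "\<dots> = (s / n + 1) ^ n"
    by (rule binomial_ring[symmetric])
  also have "\<dots> \<le> exp (s / n) ^ n"
    by (intro power_mono) (use exp_ge_add_one_self[of "s / n"] in \<open>auto simp: add.commute\<close>)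
  also have "\<dots> = exp 1 ^ s"
    using assms by (simp flip: exp_of_nat_mult)
  finally have "real (n choose s) * (s / n) ^ s * (n / s) ^ s \<le> exp 1 ^ s * (n / s) ^ s"
    by (rule mult_right_mono) simp
  moreover have "(s / n) ^ s * (n / s) ^ s = 1"
    using assms by (simp flip: power_mult_distrib)
  ultimately show ?thesis
    by (simp add: mult.assoc flip: power_mult_distrib)
qed (simp add: binomial_eq_0)

lemma sum_arith_geometric_half_le: "(\<Sum>s=1..n. real s * (1 / 2) ^ (s - 1)) \<le> 4"
proof -
  have "(\<Sum>s=1..n. real s * (1 / 2) ^ (s - 1)) = 4 - (2 * real n + 4) * (1 / 2) ^ n"
  proof (induction n)
    case (Suc n)
    then have "(\<Sum>s=1..Suc n. real s * (1 / 2) ^ (s - 1))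
        = 4 - (2 * real n + 4) * (1 / 2) ^ n + (real n + 1) * (1 / 2) ^ n"
      by (simp add: add.commute)
    also have "\<dots> = 4 - (2 * real (Suc n) + 4) * (1 / 2) ^ Suc n"
    proof -
      define h where "h = (1 / 2 :: real) ^ n"
      show ?thesis
        unfolding power_Suc h_def[symmetric] by (simp add: algebra_simps)
    qed
    finally show ?case .
  qed simp
  then show ?thesis by simp
qed

lemma exp_neg_one_le_half: "exp (- 1 :: real) \<le> 1 / 2"
  using exp_ge_add_one_self[of 1] by (simp add: exp_minus field_simps)

text \<open>There are at most \<open>(exp 1 * n / s) ^ s\<close> sets of size \<open>s\<close>, and
  \<open>card_few_crossing_le\<close> bounds the probability for each by
  \<open>(exp 12 * (s / n)\<^sup>2) ^ s\<close>. The product \<open>(exp 13 * s / n) ^ s\<close> has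
  base at most \<open>1 / 2\<close> for \<open>s \<le> exp (- 14) * n\<close>, so the sum over
  \<open>s\<close> is of order \<open>1 / n\<close>.\<close>

lemma card_sparse_small_cut_le:
  assumes "d \<ge> 8" "n > 0" "even (d * n)"
  defines "P \<equiv> perfect_matchings {..<d * n}"
  shows "card {M \<in> P. \<exists>S\<subseteq>{..<n}. S \<noteq> {} \<and> card S \<le> exp (- 14) * n \<and>
      crossing M (cell_points d n S) \<le> real (d * card S) / 2}
    \<le> card P * (4 * exp 13 / n)"
proof -
  let ?I = "{s \<in> {1..n}. real s \<le> exp (- 14) * n}"
  let ?C = "\<lambda>s. {S. S \<subseteq> {..<n} \<and> card S = s}"
  let ?B = "\<lambda>S. {M \<in> P. crossing M (cell_points d n S) \<le> real (d * card S) / 2}"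
  have finP: "finite P"
    unfolding P_def by (rule finite_perfect_matchings) simp
  have finC: "finite (?C s)" for s
    by (rule finite_subset[of _ "Pow {..<n}"]) auto
  have B: "card (?B S) \<le> card P * (exp 12 * (s / n)\<^sup>2) ^ s" if S: "S \<in> ?C s" and s: "s \<in> ?I" for s S
  proof -
    have cS: "S \<subseteq> {..<n}" "card S = s" "s > 0" and sn: "exp 6 * (s / n) \<le> 1"
    proof -
      have "real s / n \<le> exp (- 14)"
        using s assms(2) by (simp add: field_simps)
      then have "exp 6 * (s / n) \<le> exp 6 * exp (- 14)"
        by (rule mult_left_mono) simp
      also have "\<dots> \<le> (1::real)"
        by (simp flip: exp_add)
      finally show "exp 6 * (s / n) \<le> 1" .
    qed (use S s in auto)
    note cc = card_cell_points[OF cS(1), of d]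
    have ne: "cell_points d n S \<noteq> {}"
      using cc cS assms(1) by auto
    have "card (?B S) \<le> card P * (exp 6 * (d * s) / (d * n)) powr (d * s / 4)"
      using card_few_crossing_le[OF finite_lessThan cell_points_subset[of d n S] ne, of "real (d * s) / 2"]
        assms(3) cc cS unfolding P_def by simp
    also have "exp 6 * real (d * s) / real (d * n) = exp 6 * (s / n)"
      using assms(1) by simp
    \<comment> \<open>The base is at most 1, and \<open>d \<ge> 8\<close> makes the exponent at
      least \<open>2 * s\<close>: one factor \<open>s / n\<close> per vertex offsets the binomial
      coefficient, the other makes the sum small.\<close>
    also have "(exp 6 * (s / n)) powr (d * s / 4) \<le> (exp 6 * (s / n)) powr (real (2 * s))"
      using assms(1,2) cS sn by (intro powr_mono') (auto intro!: mult_right_mono)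
    also have "\<dots> = (exp 6 * (s / n)) ^ (2 * s)"
      using assms(2) cS by (subst powr_realpow) auto
    also have "\<dots> = (exp 12 * (s / n)\<^sup>2) ^ s"
      by (simp add: power_mult power_mult_distrib power_divide flip: exp_of_nat_mult)
    finally show ?thesis
      by (simp add: mult_left_mono)
  qed
  have "(\<Sum>s\<in>?I. real (n choose s) * (exp 12 * (s / n)\<^sup>2) ^ s)
      \<le> (\<Sum>s\<in>?I. exp 13 / n * (s * (1 / 2) ^ (s - 1)))"
  proof (rule sum_mono)
    fix s assume s: "s \<in> ?I"
    then have "s > 0" by auto
    have "exp 13 * real s / n \<le> exp 13 * exp (- 14)"
      using s assms(2) by (simp add: field_simps)
    also have "\<dots> \<le> (1 / 2 :: real)"
      using exp_neg_one_le_half by (simp flip: exp_add)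
    finally have half: "exp 13 * real s / n \<le> 1 / 2" .
    have "real (n choose s) * (exp 12 * (s / n)\<^sup>2) ^ s \<le> (exp 1 * n / s) ^ s * (exp 12 * (s / n)\<^sup>2) ^ s"
      using \<open>s > 0\<close> assms(2) by (intro mult_right_mono binomial_le_exp_pow) auto
    also have "\<dots> = ((exp 1 * exp 12) * s / n) ^ s"
      using \<open>s > 0\<close> assms(2) by (simp add: power2_eq_square field_simps flip: power_mult_distrib)
    also have "exp 1 * exp 12 = (exp 13 :: real)"
      by (simp flip: exp_add)
    \<comment> \<open>One factor is set aside to keep the decay in \<open>n\<close>; the others give
      a geometric series.\<close>
    also have "(exp 13 * real s / n) ^ s = exp 13 * real s / n * (exp 13 * real s / n) ^ (s - 1)"
      using \<open>s > 0\<close> by (metis Suc_diff_1 power_Suc)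
    also have "\<dots> \<le> exp 13 * real s / n * (1 / 2) ^ (s - 1)"
      using half by (intro mult_left_mono power_mono) auto
    finally show "real (n choose s) * (exp 12 * (s / n)\<^sup>2) ^ s \<le> exp 13 / n * (s * (1 / 2) ^ (s - 1))"
      by simp
  qed
  also have "\<dots> \<le> (\<Sum>s=1..n. exp 13 / n * (s * (1 / 2) ^ (s - 1)))"
    by (intro sum_mono2) auto
  also have "\<dots> = exp 13 / n * (\<Sum>s=1..n. s * (1 / 2) ^ (s - 1))"
    by (simp add: sum_distrib_left)
  also have "\<dots> \<le> exp 13 / n * 4"
    by (intro mult_left_mono sum_arith_geometric_half_le) auto
  finally have series:
    "(\<Sum>s\<in>?I. real (n choose s) * (exp 12 * (s / n)\<^sup>2) ^ s) \<le> exp 13 / n * 4" .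
  have "card {M \<in> P. \<exists>S\<subseteq>{..<n}. S \<noteq> {} \<and> card S \<le> exp (- 14) * n \<and>
      crossing M (cell_points d n S) \<le> real (d * card S) / 2} \<le> card (\<Union>s\<in>?I. \<Union>S\<in>?C s. ?B S)"
  proof (rule card_mono)
    show "finite (\<Union>s\<in>?I. \<Union>S\<in>?C s. ?B S)"
      using finP finC by auto
    have "card S \<in> {1..n}" if "S \<subseteq> {..<n}" "S \<noteq> {}" for S
      using that card_mono[OF finite_lessThan that(1)] finite_subset[OF that(1)]
      by (auto simp: Suc_le_eq card_gt_0_iff)
    then show "{M \<in> P. \<exists>S\<subseteq>{..<n}. S \<noteq> {} \<and> card S \<le> exp (- 14) * n \<and>
      crossing M (cell_points d n S) \<le> real (d * card S) / 2} \<subseteq> (\<Union>s\<in>?I. \<Union>S\<in>?C s. ?B S)"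
      by blast
  qed
  also have "\<dots> \<le> (\<Sum>s\<in>?I. card (\<Union>S\<in>?C s. ?B S))"
    by (rule card_UN_le) simp
  also have "\<dots> \<le> (\<Sum>s\<in>?I. \<Sum>S\<in>?C s. card (?B S))"
    by (intro sum_mono card_UN_le finC)
  finally have "real (card {M \<in> P. \<exists>S\<subseteq>{..<n}. S \<noteq> {} \<and> card S \<le> exp (- 14) * n \<and>
      crossing M (cell_points d n S) \<le> real (d * card S) / 2}) \<le> (\<Sum>s\<in>?I. \<Sum>S\<in>?C s. real (card (?B S)))"
    by (simp flip: of_nat_sum)
  also have "\<dots> \<le> (\<Sum>s\<in>?I. \<Sum>S\<in>?C s. card P * (exp 12 * (s / n)\<^sup>2) ^ s)"
    by (intro sum_mono B)
  also have "\<dots> = card P * (\<Sum>s\<in>?I. real (n choose s) * (exp 12 * (s / n)\<^sup>2) ^ s)"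
    by (simp add: n_subsets sum_distrib_left mult_ac)
  also have "\<dots> \<le> card P * (exp 13 / n * 4)"
    by (intro mult_left_mono series) auto
  finally show ?thesis
    by (simp add: mult.commute)
qed

section \<open>From crossing pairs to edge expansion\<close>

text \<open>Both sides count with multiplicity, since the multiset keeps pairs apart even when
  merging makes them parallel. The two points of a loop lie in the same cell, so a loop counts on
  neither side.\<close>

lemma cut_size_merge_points:
  assumes "M \<in> perfect_matchings {..<d * n}"
  shows "cut_size (merge_points d n M) S = crossing M (cell_points d n S)"
proof -
  note M = perfect_matchingsD[OF assms finite_lessThan]
  have "size {#v \<in># {#p div d. p \<in># mset_set e#}. v \<in> S#} = card (e \<inter> cell_points d n S)" if "e \<in> M" for e
  proof -
    have "e \<inter> cell_points d n S = {p \<in> e. p div d \<in> S}"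
      using M(4)[OF that] by (auto simp: cell_points_def)
    then show ?thesis
      using M(4)[OF that] by (simp add: filter_mset_image_mset)
  qed
  then have "{e \<in> M. size {#v \<in># {#p div d. p \<in># mset_set e#}. v \<in> S#} = 1}
      = {e \<in> M. card (e \<inter> cell_points d n S) = 1}"
    by (auto simp del: size_image_mset)
  then show ?thesis
    using M(1) unfolding cut_size_def merge_points_def crossing_def
    by (simp add: filter_mset_image_mset)
qed

lemma edge_expansion_merge_points_ge_iff:
  assumes "M \<in> perfect_matchings {..<d * n}" "n \<ge> 2"
  shows "edge_expansion (merge_points d n M) \<ge> x \<longleftrightarrow>
    (\<forall>S\<subseteq>{..<n}. S \<noteq> {} \<and> 2 * card S \<le> n \<longrightarrow> x * card S \<le> crossing M (cell_points d n S))"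
proof -
  let ?A = "{S. S \<noteq> {} \<and> S \<subseteq> {..<n} \<and> real (card S) \<le> real (card {..<n}) / 2}"
  have "finite ?A"
    by (rule finite_subset[of _ "Pow {..<n}"]) auto
  \<comment> \<open>For \<open>n \<ge> 2\<close> singletons are admissible, so the minimum is over a
    nonempty set.\<close>
  moreover have "{0} \<in> ?A"
    using assms(2) by auto
  then have "?A \<noteq> {}" by blast
  ultimately have "edge_expansion (merge_points d n M) \<ge> x \<longleftrightarrow>
    (\<forall>S\<in>?A. x \<le> real (crossing M (cell_points d n S)) / card S)"
    unfolding edge_expansion_def cut_size_merge_points[OF assms(1)]
    by (simp add: merge_points_def)
  also have "\<dots> \<longleftrightarrow> (\<forall>S\<in>?A. x * card S \<le> crossing M (cell_points d n S))"
  proof (intro ball_cong refl)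
    fix S assume "S \<in> ?A"
    then have "card S > 0"
      by (auto simp: card_gt_0_iff intro: finite_subset)
    then show "(x \<le> real (crossing M (cell_points d n S)) / card S) = (x * card S \<le> crossing M (cell_points d n S))"
      by (simp add: field_simps)
  qed
  also have "?A = {S. S \<noteq> {} \<and> S \<subseteq> {..<n} \<and> 2 * card S \<le> n}"
    by (intro Collect_cong conj_cong refl) auto
  finally show ?thesis
    by blast
qed

text \<open>A set violating the bound either has at least \<open>\<eta> * n / 2\<close> vertices,
  where the partition function applies, or fewer, hence at most \<open>exp (- 14) * n\<close>. In
  the second case its cut is also at most \<open>d / 2\<close> per vertex, which the union bound
  covers.\<close>

lemma prob_edge_expansion_ge:
  fixes \<epsilon> \<eta> :: real
  assumes "d \<ge> 8" "n \<ge> 2" "even (d * n)" "0 < \<epsilon>" "\<epsilon> < 1" "0 \<le> \<eta>" "\<eta> / 2 \<le> exp (- 14)"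
  defines "\<rho> \<equiv> (1 - 2 * \<epsilon>)\<^sup>2"
  shows "measure_pmf.prob (random_regular_graph d n) {G. edge_expansion G \<ge> (1 - \<eta>) * (d / 2)}
    \<ge> 1 - (4 * exp 13 / n + (real d * real n + 1) * exp (\<rho> * (1 - \<rho>) * \<eta> * d / 2) *
        exp (n * (ln 2 - \<epsilon> * ln (1 / \<epsilon>) - \<rho>\<^sup>2 * \<eta>\<^sup>2 * d / 4)))"
    (is "_ \<ge> 1 - (?small + ?large)")
proof -
  define P where "P = perfect_matchings {..<d * n}"
  let ?c = "\<lambda>M S. real (crossing M (cell_points d n S))"
  let ?good = "{M \<in> P. edge_expansion (merge_points d n M) \<ge> (1 - \<eta>) * (d / 2)}"
  let ?bad1 = "{M \<in> P. \<exists>S\<subseteq>{..<n}. S \<noteq> {} \<and> card S \<le> exp (- 14) * n \<and> ?c M S \<le> real (d * card S) / 2}"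
  let ?bad2 = "{M \<in> P. \<exists>S\<subseteq>{..<n}. 2 * card S \<le> n \<and> \<eta> * n / 2 \<le> card S \<and>
      ?c M S \<le> (1 - \<eta>) * (d / 2) * card S}"
  have finP: "finite P" and neP: "P \<noteq> {}"
    using perfect_matchings_nonempty[OF assms(3)] finite_perfect_matchings[of "{..<d * n}"]
    by (auto simp: P_def)
  then have cP: "card P > 0"
    by (simp add: card_gt_0_iff)
  have "P \<subseteq> ?good \<union> (?bad1 \<union> ?bad2)"
  proof
    fix M assume M: "M \<in> P"
    show "M \<in> ?good \<union> (?bad1 \<union> ?bad2)"
    proof (cases "M \<in> ?good")
      case False
      then have "\<not> (1 - \<eta>) * (d / 2) \<le> edge_expansion (merge_points d n M)"
        using M by simp
      then obtain S where S: "S \<subseteq> {..<n}" "S \<noteq> {}" "2 * card S \<le> n"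
        and c: "?c M S < (1 - \<eta>) * (d / 2) * card S"
        using M assms(2) unfolding P_def by (metis edge_expansion_merge_points_ge_iff not_le)
      show ?thesis
      proof (cases "\<eta> * n / 2 \<le> card S")
        case True
        then have "M \<in> ?bad2"
          using M S c by (auto intro!: exI[of _ S])
        then show ?thesis by blast
      next
        case False
        have "card S \<le> exp (- 14) * n"
          using False mult_right_mono[OF assms(7), of n] by simp
        moreover have "(1 - \<eta>) * (real d / 2) * card S \<le> 1 * (real d / 2) * card S"
          using assms(6) by (intro mult_right_mono) auto
        then have "?c M S \<le> real (d * card S) / 2"
          using c by simp
        ultimately have "M \<in> ?bad1"
          using M S by (auto intro!: exI[of _ S])
        then show ?thesis by blast
      qed
    qed blast
  qed
  then have "card P \<le> card (?good \<union> (?bad1 \<union> ?bad2))"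
    using finP by (intro card_mono) auto
  also have "\<dots> \<le> card ?good + (card ?bad1 + card ?bad2)"
    by (intro order_trans[OF card_Un_le] add_left_mono card_Un_le)
  finally have "real (card P) \<le> card ?good + (real (card ?bad1) + real (card ?bad2))"
    by (simp flip: of_nat_add)
  also have "\<dots> \<le> card ?good + (card P * ?small + card P * ?large)"
    using card_sparse_small_cut_le[of d n] card_sparse_large_cut_le[of d n \<epsilon> \<eta>] assms
    unfolding P_def \<rho>_def by (intro add_left_mono add_mono) auto
  finally have "card P * (1 - (?small + ?large)) \<le> card ?good"
    by (simp add: algebra_simps)
  then have "1 - (?small + ?large) \<le> card ?good / card P"
    using cP by (simp add: pos_le_divide_eq mult.commute)
  also have "\<dots> = measure_pmf.prob (random_regular_graph d n) {G. edge_expansion G \<ge> (1 - \<eta>) * (d / 2)}"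
    unfolding random_regular_graph_def P_def[symmetric] using finP neP
    by (simp add: measure_pmf_of_set vimage_def Int_def)
  finally show ?thesis .
qed

section \<open>Choice of constants and passage to the limit\<close>

theorem theorem2:
  shows "\<exists>(\<alpha>::real) (\<Delta>\<^sub>0::nat). \<alpha> < 2 * sqrt (ln 2) \<and>
    (\<forall>\<Delta>\<ge>\<Delta>\<^sub>0.
      ((\<lambda>n. measure_pmf.prob (random_regular_graph \<Delta> n)
              {G. edge_expansion G \<ge> (1 - \<alpha> / sqrt (real \<Delta>)) * (real \<Delta> / 2)})
        \<longlongrightarrow> 1) (inf sequentially (principal {n. even (\<Delta> * n)})))"
proof -
  \<comment> \<open>In units of \<open>ln 2\<close>, the factor \<open>\<rho>\<^sup>2\<close> loses
    about \<open>8 * \<epsilon>\<close>, so the entropy wins once \<epsilon> is below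
    \<open>1 / 256\<close>. For \<open>\<epsilon> = 1 / 512\<close> it gains \<open>9 / 512\<close>.
    Half of the surplus of about \<open>1 / 512\<close> pays for lowering
    \<open>\<alpha>\<^sup>2 / 4\<close> from \<open>ln 2\<close> to
    \<open>1023 / 1024 * ln 2\<close>; the other half is the decay rate.\<close>
  define \<alpha> :: real where "\<alpha> = 2 * sqrt (1023 / 1024 * ln 2)"
  define \<rho> :: real where "\<rho> = (1 - 2 * (1 / 512))\<^sup>2"
  \<comment> \<open>Together with \<open>\<alpha> \<le> 2\<close> this gives
    \<open>\<eta> / 2 \<le> exp (- 14)\<close>, so that all sets below \<open>\<eta> * n / 2\<close>
    vertices fall under the union bound.\<close>
  define \<Delta>\<^sub>0 where "\<Delta>\<^sub>0 = nat \<lceil>exp 28 :: real\<rceil>"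
  have \<alpha>2: "\<alpha>\<^sup>2 = 1023 / 256 * ln 2"
    unfolding \<alpha>_def by (simp add: power_mult_distrib)
  have \<alpha>: "0 \<le> \<alpha>" "\<alpha> < 2 * sqrt (ln 2)"
    unfolding \<alpha>_def by auto
  have "sqrt (ln 2) \<le> 1"
    using ln_2_less_1 by simp
  with \<alpha> have "\<alpha> \<le> 2" by linarith
  have lim: "((\<lambda>n. measure_pmf.prob (random_regular_graph \<Delta> n)
              {G. edge_expansion G \<ge> (1 - \<alpha> / sqrt (real \<Delta>)) * (real \<Delta> / 2)})
        \<longlongrightarrow> 1) (inf sequentially (principal {n. even (\<Delta> * n)}))" (is "(?p \<longlongrightarrow> 1) ?F")
    if \<Delta>: "\<Delta> \<ge> \<Delta>\<^sub>0" for \<Delta>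
  proof -
    define \<eta> where "\<eta> = \<alpha> / sqrt \<Delta>"
    \<comment> \<open>The contribution of the diagonal correction \<open>d / 4\<close> to the
      energy. It is constant in \<open>n\<close>, as \<Delta> is fixed before the limit.\<close>
    define K where "K = exp (\<rho> * (1 - \<rho>) * \<eta> * \<Delta> / 2)"
    define b where "b n = 4 * exp 13 / real n + (real \<Delta> * real n + 1) * K * exp (- (ln 2 / 1024) * n)" for n
    have \<Delta>28: "exp 28 \<le> real \<Delta>"
      using \<Delta> unfolding \<Delta>\<^sub>0_def by linarith
    have "\<Delta> \<ge> 8"
      using \<Delta>28 exp_ge_add_one_self[of 28] by linarith
    have "exp 14 \<le> sqrt \<Delta>"
      using \<Delta>28 by (intro real_le_rsqrt) (simp flip: exp_of_nat_mult)
    then have "\<eta> / 2 \<le> 2 / exp 14 / 2"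
      unfolding \<eta>_def using \<alpha> \<open>\<alpha> \<le> 2\<close> by (intro divide_right_mono frac_le) auto
    then have \<eta>: "0 \<le> \<eta>" "\<eta> / 2 \<le> exp (- 14)"
      using \<alpha> by (auto simp: \<eta>_def exp_minus field_simps)
    \<comment> \<open>This scaling makes the decay rate below independent of \<Delta>.\<close>
    have \<eta>2: "\<eta>\<^sup>2 * \<Delta> = \<alpha>\<^sup>2"
      using \<open>\<Delta> \<ge> 8\<close> by (simp add: \<eta>_def power_divide)
    have "ln 512 = ln (2 ^ 9 :: real)" by simp
    also have "\<dots> = 9 * ln 2" by (subst ln_realpow) auto
    finally have "ln 2 - 1 / 512 * ln (1 / (1 / 512)) - \<rho>\<^sup>2 * \<eta>\<^sup>2 * \<Delta> / 4
        = ln 2 * (1 - 9 / 512 - (255 / 256) ^ 4 * (1023 / 1024))"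
      using \<eta>2[unfolded \<alpha>2] by (simp add: \<rho>_def field_simps)
    also have "\<dots> \<le> ln 2 * (- 1 / 1024)"
      by (intro mult_left_mono) (simp_all add: power_divide)
    finally have rate: "ln 2 - 1 / 512 * ln (1 / (1 / 512)) - \<rho>\<^sup>2 * \<eta>\<^sup>2 * \<Delta> / 4 \<le> - (ln 2 / 1024)"
      by simp
    have lower: "1 - b n \<le> ?p n" if "n \<ge> 2" "even (\<Delta> * n)" for n
    proof -
      have "(real \<Delta> * real n + 1) * K * exp (n * (ln 2 - 1 / 512 * ln (1 / (1 / 512)) - \<rho>\<^sup>2 * \<eta>\<^sup>2 * \<Delta> / 4))
          \<le> (real \<Delta> * real n + 1) * K * exp (n * - (ln 2 / 1024))"
        using rate by (intro mult_left_mono exp_mono) (auto simp: K_def)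
      then show ?thesis
        using prob_edge_expansion_ge[OF \<open>\<Delta> \<ge> 8\<close> that, of "1 / 512" \<eta>] \<eta>
        unfolding b_def K_def \<rho>_def \<eta>_def by (simp add: mult.commute)
    qed
    have "b \<longlonglongrightarrow> 0"
      unfolding b_def by real_asymp
    then have "(\<lambda>n. 1 - b n) \<longlonglongrightarrow> 1 - 0"
      by (intro tendsto_intros)
    then have b: "((\<lambda>n. 1 - b n) \<longlongrightarrow> 1) ?F"
      by (simp add: tendsto_mono[OF inf_le1])
    show ?thesis
    proof (rule tendsto_sandwich[OF _ _ b tendsto_const])
      have "\<forall>\<^sub>F n in sequentially. even (\<Delta> * n) \<longrightarrow> 1 - b n \<le> ?p n"
        using eventually_ge_at_top[of 2] by eventually_elim (use lower in blast)
      then show "\<forall>\<^sub>F n in ?F. 1 - b n \<le> ?p n"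
        by (simp add: eventually_inf_principal)
    qed (auto intro!: always_eventually)
  qed
  show ?thesis
    using \<alpha>(2) lim by blast
qed

end
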